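(* Let $(\mathcal{X},\mathcal{X}')$ be a pair of random variables with values in $\mathbb{N}^2$, $\mathbb{N}=\{0,1,2,\dots\}$, such that $\mathbb{E}(\mathcal{X})>1$, $\mathbb{P}(\mathcal{X}=0)>0$ and $\mathcal{X}+\mathcal{X}'\ge 1$ almost surely. Let $v_N$ be the asymptotic speed of the $N$-particle branching-selection process with distribution $(\mathcal{X},\mathcal{X}')$, and let $q$ be the extinction probability of the Galton-Watson process with offspring $\mathcal{X}$ started from one individual. Then $$\lim_{N\to\infty}\frac{1-v_N}{q^N}=1.$$
   Context: The branching-selection process with distribution $(\mathcal{X},\mathcal{X}')$ is the discrete-time system of $N$ particles on $\mathbb{Z}$, all starting at the origin, such that at each time unit: (1) each of the $N$ particles, independently of the others, is replaced by $\mathcal{X}$ particles at the site immediately to the right of its position (position $+1$) and $\mathcal{X}'$ particles at its own position, where $(\mathcal{X},\mathcal{X}')$ is a fresh sample from the given joint law; (2) among all these new particles only the $N$ rightmost are kept. Let $Y^N_k(\ell)$ be the number of particles at position $\ell$ at time $k$ (so $Y^N_0(0)=N$ and $\sum_{\ell\ge 0}Y^N_k(\ell)=N$), and $\max Y^N_k=\max\{\ell\ge 0: Y^N_k(\ell)>0\}$ the position of the rightmost particle. The speed $v_N$ is the deterministic constant $v_N=\lim_{k\to\infty}(\max Y^N_k)/k$ (almost sure limit, which exists). The Galton-Watson process with offspring $\mathcal{X}$ is $Z_0=1$, $Z_{k+1}=\sum_{i=1}^{Z_k}X_{k,i}$ with $X_{k,i}$ i.i.d. copies of $\mathcal{X}$;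 $q=\mathbb{P}(\exists k: Z_k=0)$. The mean $\mathbb{E}(\mathcal{X})$ may be infinite. *)

theory Defs
  imports "HOL-Probability.Probability"
begin

text \<open>
  All randomness comes from an array of independent samples with a common law: the entry with
  index \<open>(k, i)\<close> is used at time \<open>k\<close> by the \<open>i\<close>-th individual alive at that time.
\<close>

definition iid_array :: "'a pmf \<Rightarrow> (nat \<times> nat \<Rightarrow> 'a) measure" where
  "iid_array p = (\<Pi>\<^sub>M _\<in>UNIV. measure_pmf p)"

primrec galton_watson :: "(nat \<times> nat \<Rightarrow> nat) \<Rightarrow> nat \<Rightarrow> nat" where
  "galton_watson \<omega> 0 = 1"
| "galton_watson \<omega> (Suc k) = (\<Sum>i=1..galton_watson \<omega> k. \<omega> (k, i))"

definition extinction_prob :: "nat pmf \<Rightarrow> real" where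
  "extinction_prob r = measure (iid_array r) {\<omega>. \<exists>k. galton_watson \<omega> k = 0}"

definition offspring :: "nat \<times> nat \<Rightarrow> int \<Rightarrow> int list" where
  "offspring x z = replicate (fst x) (z + 1) @ replicate (snd x) z"

definition rightmost :: "nat \<Rightarrow> int list \<Rightarrow> int list" where
  "rightmost N zs = take N (rev (sort zs))"

text \<open>
  The configuration is the list of the positions of all particles, with repetitions. The order
  of the list only serves to assign the samples to the particles. If every sample has at least one
  child, then the list always has length \<open>N\<close>.
\<close>

primrec particles :: "nat \<Rightarrow> (nat \<times> nat \<Rightarrow> nat \<times> nat) \<Rightarrow> nat \<Rightarrow> int list" where
  "particles N \<omega> 0 = replicate N 0"
| "particles N \<omega> (Suc k) =
     rightmost N (concat (map (\<lambda>i. offspring (\<omega> (k, i)) (particles N \<omega> k ! i))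
       [0..<length (particles N \<omega> k)]))"

definition Y :: "nat \<Rightarrow> (nat \<times> nat \<Rightarrow> nat \<times> nat) \<Rightarrow> nat \<Rightarrow> int \<Rightarrow> nat" where
  "Y N \<omega> k l = count_list (particles N \<omega> k) l"

definition max_Y :: "nat \<Rightarrow> (nat \<times> nat \<Rightarrow> nat \<times> nat) \<Rightarrow> nat \<Rightarrow> int" where
  "max_Y N \<omega> k = Max {l. l \<ge> 0 \<and> Y N \<omega> k l > 0}"

definition speed :: "(nat \<times> nat) pmf \<Rightarrow> nat \<Rightarrow> real" where
  "speed p N = (THE v. AE \<omega> in iid_array p. (\<lambda>k. real_of_int (max_Y N \<omega> k) / real k) \<longlonglongrightarrow> v)"

lemma speed_eqI:
  assumes "AE \<omega> in iid_array p. (\<lambda>k. real_of_int (max_Y N \<omega> k) / real k) \<longlonglongrightarrow> v"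
  shows "speed p N = v"
  unfolding speed_def
proof (rule the_equality)
  show "AE \<omega> in iid_array p. (\<lambda>k. real_of_int (max_Y N \<omega> k) / real k) \<longlonglongrightarrow> v"
    by (fact assms)
next
  interpret prob_space "iid_array p"
    unfolding iid_array_def by (intro prob_space_PiM measure_pmf.prob_space_axioms)
  fix w assume "AE \<omega> in iid_array p. (\<lambda>k. real_of_int (max_Y N \<omega> k) / real k) \<longlonglongrightarrow> w"
  with assms have "AE \<omega> in iid_array p. w = v"
    by eventually_elim (rule LIMSEQ_unique)
  then show "w = v" by simp
qed

end

theory Submission
  imports Defs
begin

text \<open>
  Call leaders the particles at the rightmost occupied site.
  The front fails to advance exactly when no leader has a child to its right, so \<open>1 - v\<^sub>N\<close> is the
  asymptotic frequency of failures. Without failures the number \<open>A\<close> of leaders is a Galton-Watson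
  process truncated at \<open>N\<close>. Since \<open>f q = q\<close> for the generating function \<open>f\<close> of the offspring to the
  right, balancing \<open>q ^ A\<close> over a step, with \<open>S\<close> children before truncation, shows that on average
  \<open>P(failure) = E (q ^ N - q ^ S)\<^sup>+ + E (q ^ A'; failure)\<close>.

  If \<open>f s < s\<close> then \<open>s ^ A\<close> contracts up to an error \<open>s ^ N\<close>, so \<open>E s ^ A = O(s ^ N)\<close>. Hence \<open>S\<close> is
  typically much larger than \<open>N\<close> and the first term is asymptotic to \<open>q ^ N\<close>. For the second term,
  \<open>x ^ A * q ^ B\<close> with \<open>x\<close> slightly less than \<open>q\<close> and \<open>B\<close> the number of particles one site behind also contracts,
  because an individual with no child to its right keeps a child in place; its mean is therefore
  \<open>o(q ^ N)\<close>, and so is the second term: a failure leaves many new leaders.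

  The speed exists because displacements over blocks of time satisfy a law of large numbers once the
  system is restarted from a single site at the beginning of each block, and the restart changes the
  displacement by a quantity whose mean is negligible compared with the length of the block.
\<close>

section \<open>Independent blocks of an i.i.d. array\<close>

text \<open>The point \<open>q\<close> is critical: apart from truncation and failures the mean of
  \<open>q ^ A\<close> does not change, so it gives an exact balance but no decay. Every upper bound
  therefore works at a point \<open>s\<close> with \<open>f s < s\<close>, where
  \<open>A \<ge> 1\<close> turns \<open>f s < s\<close> into a contraction by the ratio
  \<open>f s / s\<close>. Such points exist arbitrarily close to 1 even if the mean is infinite, and
  the estimates average only bounded functions of the counts.

  The delicate term is a failure that leaves few leaders. The leaders after a failure descend from
  two sites, the old front and the one behind it, so a weight on both is required. Weight
  \<open>q\<close> on the site behind is preserved exactly, since \<open>f q = q\<close>. On the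
  front, the children in place lower the value at \<open>(q, q)\<close> below \<open>q\<close> by at
  least \<open>(1 - q) P(X = 0)\<close>, and this gap leaves room for a weight \<open>x < q\<close>
  that still contracts. The inequality \<open>x < q\<close> is strict for a second reason: when
  selection cuts the site behind, the weight becomes \<open>q ^ N * (x / q) ^ S\<close>, and the
  mean of \<open>(x / q) ^ S\<close> is exponentially small in \<open>N\<close>.\<close>

definition iid :: "'a pmf \<Rightarrow> ('i \<Rightarrow> 'a) measure" where
  "iid p = (\<Pi>\<^sub>M _\<in>UNIV. measure_pmf p)"

text \<open>\<open>iid\<close> leaves the index type free, so that the same facts serve whole arrays
  and the single row of samples used in one time step.\<close>

lemma iid_array_eq_iid: "iid_array p = iid p"
  by (simp add: iid_array_def iid_def)

lemma prob_space_iid: "prob_space (iid p)"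
  unfolding iid_def by (intro prob_space_PiM measure_pmf.prob_space_axioms)

lemma space_iid [simp]: "space (iid p) = UNIV"
  by (simp add: iid_def space_PiM)

lemma sets_iid: "sets (iid p :: ('i \<Rightarrow> 'a) measure) = sets (\<Pi>\<^sub>M _\<in>(UNIV::'i set). count_space UNIV)"
  unfolding iid_def by (rule sets_PiM_cong) auto

lemma measurable_iid_coord [measurable]: "(\<lambda>\<omega>. \<omega> i) \<in> measurable (iid p) (count_space UNIV)"
  unfolding measurable_cong_sets[OF sets_iid refl] by measurable

lemma measurable_into_iid:
  assumes "\<And>i. (\<lambda>x. f x i) \<in> measurable M (count_space UNIV)"
  shows "f \<in> measurable M (iid p)"
  unfolding measurable_cong_sets[OF refl sets_iid]
  by (rule measurable_PiM_single') (use assms in auto)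

text \<open>Used with \<open>\<lambda>i. (k, i)\<close>, which extracts a row, and with time shifts,
  which extract a block: both see a fresh i.i.d. family.\<close>

lemma distr_iid_reindex:
  fixes f :: "'i \<Rightarrow> 'j"
  assumes "inj f"
  shows "distr (iid p) (iid p) (\<lambda>\<omega> i. \<omega> (f i)) = iid p"
  using distr_PiM_reindex[of UNIV "\<lambda>_. measure_pmf p" f UNIV] assms
  by (simp add: iid_def measure_pmf.prob_space_axioms restrict_UNIV)

lemma measurable_reindex: "(\<lambda>\<omega> i. \<omega> (f i)) \<in> measurable (iid p) (iid p)"
  by (rule measurable_into_iid) (rule measurable_iid_coord)

lemma distr_iid_coord: "distr (iid p) (measure_pmf p) (\<lambda>\<omega>. \<omega> i) = measure_pmf p"
  unfolding iid_def by (rule distr_PiM_component) (auto simp: measure_pmf.prob_space_axioms)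

lemma indep_vars_iid: "prob_space.indep_vars (iid p) (\<lambda>_. measure_pmf p) (\<lambda>i \<omega>. \<omega> i) UNIV"
proof -
  interpret prob_space "iid p" by (rule prob_space_iid)
  have rv: "random_variable (measure_pmf p) (\<lambda>\<omega>. \<omega> i)" for i
    unfolding measurable_pmf_measure2 by (rule measurable_iid_coord)
  have "distr (iid p) (\<Pi>\<^sub>M i\<in>UNIV. measure_pmf p) (\<lambda>x. \<lambda>i\<in>UNIV. x i) =
      (\<Pi>\<^sub>M i\<in>UNIV. distr (iid p) (measure_pmf p) (\<lambda>\<omega>. \<omega> i))"
    unfolding distr_iid_coord restrict_UNIV unfolding iid_def by (rule distr_id)
  then show ?thesis
    by (subst indep_vars_iff_distr_eq_PiM[OF _ rv]) (rule UNIV_not_empty)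
qed

text \<open>Stated pointwise and not through a sub-sigma-algebra: \<open>X\<close> takes the same
  value on the sample restricted to \<open>J\<close>, while measurability always refers to the full
  product.\<close>

definition depends_on :: "(('i \<Rightarrow> 'a) \<Rightarrow> 'c) \<Rightarrow> 'i set \<Rightarrow> bool" where
  "depends_on X J \<longleftrightarrow> (\<forall>\<omega> \<omega>'. (\<forall>i\<in>J. \<omega> i = \<omega>' i) \<longrightarrow> X \<omega> = X \<omega>')"

lemma depends_onD: "depends_on X J \<Longrightarrow> (\<And>i. i \<in> J \<Longrightarrow> \<omega> i = \<omega>' i) \<Longrightarrow> X \<omega> = X \<omega>'"
  by (auto simp: depends_on_def)

text \<open>A sample indexed by \<open>J\<close> is \<open>undefined\<close> outside
  \<open>J\<close>. Its coordinates there are constant, so it can be fed to functions that are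
  measurable on the full product.\<close>

lemma measurable_PiM_of_iid:
  assumes X: "X \<in> measurable (iid p) N"
  shows "X \<in> measurable (\<Pi>\<^sub>M _\<in>J. measure_pmf p) N"
proof -
  have "(\<lambda>\<omega>. \<omega>) \<in> measurable (\<Pi>\<^sub>M _\<in>J. measure_pmf p) (iid p)"
  proof (rule measurable_into_iid)
    fix i
    show "(\<lambda>\<omega>. \<omega> i) \<in> measurable (\<Pi>\<^sub>M _\<in>J. measure_pmf p) (count_space UNIV)"
    proof (cases "i \<in> J")
      case True
      then have "(\<lambda>\<omega>. \<omega> i) \<in> measurable (\<Pi>\<^sub>M _\<in>J. measure_pmf p) (measure_pmf p)"
        by (rule measurable_component_singleton)
      then show ?thesis by (simp add: measurable_pmf_measure2)
    next
      case False
      have "(\<lambda>\<omega>. undefined) \<in> measurable (\<Pi>\<^sub>M _\<in>J. measure_pmf p) (count_space UNIV)" by simp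
      then show ?thesis
        by (rule measurable_cong[THEN iffD1, rotated]) (auto simp: space_PiM PiE_def extensional_def False)
    qed
  qed
  from measurable_comp[OF this X] show ?thesis by (simp add: comp_def)
qed

text \<open>Each \<open>X j\<close> is unchanged when the sample is restricted to
  \<open>K j\<close>, and restrictions to disjoint index sets are independent.\<close>

lemma indep_vars_blocks:
  fixes X :: "'l \<Rightarrow> ('i \<Rightarrow> 'a) \<Rightarrow> 'c"
  assumes "\<And>j. X j \<in> measurable (iid p) (N j)" and d: "\<And>j. depends_on (X j) (K j)"
    and "disjoint_family K"
  shows "prob_space.indep_vars (iid p) N X UNIV"
proof -
  interpret prob_space "iid p" by (rule prob_space_iid)
  have "indep_vars (\<lambda>j. Pi\<^sub>M (K j) (\<lambda>_. measure_pmf p)) (\<lambda>j \<omega>. restrict (\<lambda>i. \<omega> i) (K j)) UNIV"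
    by (rule indep_vars_restrict[OF indep_vars_iid]) (use assms in auto)
  then have "indep_vars N (\<lambda>j \<omega>. X j (restrict (\<lambda>i. \<omega> i) (K j))) UNIV"
    by (rule indep_vars_compose2) (use assms in \<open>auto intro: measurable_PiM_of_iid\<close>)
  moreover have "X j (restrict \<omega> (K j)) = X j \<omega>" for j \<omega>
    by (rule depends_onD[OF d]) auto
  ultimately show ?thesis by simp
qed

text \<open>The same argument for two variables whose values may have different types, in the form
  of a product law, ready for Fubini's theorem.\<close>

lemma distr_pair_blocks:
  fixes X :: "('i \<Rightarrow> 'a) \<Rightarrow> 'c" and Y :: "('i \<Rightarrow> 'a) \<Rightarrow> 'd"
  assumes X: "X \<in> measurable (iid p) N" and dX: "depends_on X A"
    and Y: "Y \<in> measurable (iid p) N'" and dY: "depends_on Y B" and "A \<inter> B = {}"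
  shows "distr (iid p) (N \<Otimes>\<^sub>M N') (\<lambda>\<omega>. (X \<omega>, Y \<omega>)) = distr (iid p) N X \<Otimes>\<^sub>M distr (iid p) N' Y"
proof -
  interpret prob_space "iid p" by (rule prob_space_iid)
  let ?A = "\<Pi>\<^sub>M _\<in>A. measure_pmf p" and ?B = "\<Pi>\<^sub>M _\<in>B. measure_pmf p"
  let ?a = "\<lambda>\<omega>. restrict (\<lambda>i. \<omega> i) A" and ?b = "\<lambda>\<omega>. restrict (\<lambda>i. \<omega> i) B"
  have "indep_var ?A ?a ?B ?b"
    by (rule indep_var_restrict[OF indep_vars_iid]) (use assms in auto)
  from indep_var_distribution_eq[THEN iffD1, OF this]
  have a[measurable]: "?a \<in> measurable (iid p) ?A" and b[measurable]: "?b \<in> measurable (iid p) ?B"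
    and eq: "distr (iid p) ?A ?a \<Otimes>\<^sub>M distr (iid p) ?B ?b =
      distr (iid p) (?A \<Otimes>\<^sub>M ?B) (\<lambda>\<omega>. (?a \<omega>, ?b \<omega>))" by auto
  have X'[measurable]: "X \<in> measurable ?A N" and Y'[measurable]: "Y \<in> measurable ?B N'"
    using X Y by (auto intro: measurable_PiM_of_iid)
  have Xa: "X (?a \<omega>) = X \<omega>" and Yb: "Y (?b \<omega>) = Y \<omega>" for \<omega>
    by (auto intro!: depends_onD[OF dX] depends_onD[OF dY])
  have "distr (iid p) N X \<Otimes>\<^sub>M distr (iid p) N' Y =
      distr (distr (iid p) ?A ?a) N X \<Otimes>\<^sub>M distr (distr (iid p) ?B ?b) N' Y"
    unfolding distr_distr[OF X' a] distr_distr[OF Y' b] by (simp only: comp_def Xa Yb)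
  also have "\<dots> = distr (distr (iid p) ?A ?a \<Otimes>\<^sub>M distr (iid p) ?B ?b) (N \<Otimes>\<^sub>M N') (\<lambda>(x, y). (X x, Y y))"
  proof (rule pair_measure_distr)
    have "prob_space (distr (distr (iid p) ?B ?b) N' Y)"
      by (rule prob_space.prob_space_distr[OF prob_space_distr[OF b] ]) measurable
    then show "sigma_finite_measure (distr (distr (iid p) ?B ?b) N' Y)"
      by (simp add: prob_space_imp_sigma_finite)
  qed measurable
  also have "\<dots> = distr (iid p) (N \<Otimes>\<^sub>M N') (\<lambda>\<omega>. (X \<omega>, Y \<omega>))"
    unfolding eq by (subst distr_distr, measurable) (simp only: comp_def Xa Yb prod.case)
  finally show ?thesis ..
qed

text \<open>The Markov property at time \<open>k\<close>: a state built from earlier rows is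
  independent of row \<open>k\<close>, which is integrated out with the state frozen. A countable
  state type reduces joint measurability of \<open>h\<close> to one state at a time.\<close>

lemma expectation_indep_row:
  fixes X :: "(nat \<times> nat \<Rightarrow> 'a) \<Rightarrow> 'c :: countable" and h :: "'c \<Rightarrow> (nat \<Rightarrow> 'a) \<Rightarrow> real"
  assumes X: "X \<in> measurable (iid p) (count_space UNIV)" and dX: "depends_on X ({..<k} \<times> UNIV)"
    and h: "\<And>c. h c \<in> borel_measurable (iid p)" and C: "\<And>c \<rho>. \<bar>h c \<rho>\<bar> \<le> C"
  shows "(\<integral>\<omega>. h (X \<omega>) (\<lambda>i. \<omega> (k, i)) \<partial>iid p) = (\<integral>\<omega>. (\<integral>\<rho>. h (X \<omega>) \<rho> \<partial>iid p) \<partial>iid p)"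
proof -
  interpret P: prob_space "iid p :: (nat \<times> nat \<Rightarrow> 'a) measure" by (rule prob_space_iid)
  interpret Q: prob_space "iid p :: (nat \<Rightarrow> 'a) measure" by (rule prob_space_iid)
  let ?P = "iid p :: (nat \<times> nat \<Rightarrow> 'a) measure" and ?Q = "iid p :: (nat \<Rightarrow> 'a) measure"
  let ?R = "\<lambda>\<omega> :: nat \<times> nat \<Rightarrow> 'a. \<lambda>i. \<omega> (k, i)"
  let ?D = "distr ?P (count_space UNIV) X"
  interpret D: prob_space ?D by (rule P.prob_space_distr[OF X])
  interpret DQ: pair_prob_space ?D ?Q ..
  have R: "?R \<in> measurable ?P ?Q" by (rule measurable_reindex)
  have eq: "?D \<Otimes>\<^sub>M ?Q = distr ?P (count_space UNIV \<Otimes>\<^sub>M ?Q) (\<lambda>\<omega>. (X \<omega>, ?R \<omega>))"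
  proof -
    have "{..<k} \<times> UNIV \<inter> {k} \<times> (UNIV :: nat set) = {}" and "inj (\<lambda>i::nat. (k, i))"
      and "depends_on ?R ({k} \<times> UNIV)"
      by (auto simp: inj_on_def depends_on_def)
    then show ?thesis
      using distr_pair_blocks[OF X dX R, of "{k} \<times> UNIV"] distr_iid_reindex[of "\<lambda>i::nat. (k, i)" p] by simp
  qed
  have hm: "(\<lambda>z. h (fst z) (snd z)) \<in> borel_measurable (count_space UNIV \<Otimes>\<^sub>M ?Q)"
    by (rule measurable_pair_measure_countable1) (use h in auto)
  have s: "sets (?D \<Otimes>\<^sub>M ?Q) = sets (count_space UNIV \<Otimes>\<^sub>M ?Q)"
    by (rule sets_pair_measure_cong) auto
  have hi: "integrable (?D \<Otimes>\<^sub>M ?Q) (\<lambda>z. h (fst z) (snd z))"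
    by (rule DQ.P.integrable_const_bound[where B=C])
       (use C hm in \<open>auto simp: measurable_cong_sets[OF s refl]\<close>)
  have XR: "(\<lambda>\<omega>. (X \<omega>, ?R \<omega>)) \<in> measurable ?P (count_space UNIV \<Otimes>\<^sub>M ?Q)"
    using X R by measurable
  have "(\<integral>\<omega>. h (X \<omega>) (?R \<omega>) \<partial>?P) = (\<integral>z. h (fst z) (snd z) \<partial>(?D \<Otimes>\<^sub>M ?Q))"
    unfolding eq by (subst integral_distr[OF XR hm]) simp
  also have "\<dots> = (\<integral>c. (\<integral>\<rho>. h c \<rho> \<partial>?Q) \<partial>?D)"
    using DQ.integral_fst[of "\<lambda>c \<rho>. h c \<rho>"] hi by (simp add: case_prod_unfold)
  also have "\<dots> = (\<integral>\<omega>. (\<integral>\<rho>. h (X \<omega>) \<rho> \<partial>?Q) \<partial>?P)"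
    by (rule integral_distr[OF X]) simp
  finally show ?thesis .
qed

lemma expectation_prod_iid:
  fixes F :: "'i \<Rightarrow> 'a \<Rightarrow> real"
  assumes "finite I" and C: "\<And>i x. i \<in> I \<Longrightarrow> \<bar>F i x\<bar> \<le> C"
  shows "(\<integral>\<omega>. (\<Prod>i\<in>I. F i (\<omega> i)) \<partial>iid p) = (\<Prod>i\<in>I. \<integral>x. F i x \<partial>measure_pmf p)"
proof -
  interpret prob_space "iid p :: ('i \<Rightarrow> 'a) measure" by (rule prob_space_iid)
  have "indep_vars (\<lambda>_. measure_pmf p) (\<lambda>i \<omega>. \<omega> i) I"
    by (rule indep_vars_subset[OF indep_vars_iid]) auto
  then have "indep_vars (\<lambda>_. borel) (\<lambda>i \<omega>. F i (\<omega> i)) I"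
    by (rule indep_vars_compose2) auto
  moreover have "integrable (iid p) (\<lambda>\<omega>. F i (\<omega> i))" if "i \<in> I" for i
    by (rule integrable_const_bound[where B=C]) (use C[OF that] in \<open>auto intro: measurable_compose[OF measurable_iid_coord]\<close>)
  ultimately have "(\<integral>\<omega>. (\<Prod>i\<in>I. F i (\<omega> i)) \<partial>iid p) = (\<Prod>i\<in>I. \<integral>\<omega>. F i (\<omega> i) \<partial>iid p)"
    using assms by (intro indep_vars_lebesgue_integral) auto
  also have "\<dots> = (\<Prod>i\<in>I. \<integral>x. F i x \<partial>measure_pmf p)"
  proof (rule prod.cong[OF refl])
    fix i :: 'i
    have m: "(\<lambda>\<omega>. \<omega> i) \<in> measurable (iid p) (measure_pmf p)"
      by (simp add: measurable_pmf_measure2)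
    show "(\<integral>\<omega>. F i (\<omega> i) \<partial>iid p) = (\<integral>x. F i x \<partial>measure_pmf p)"
      using integral_distr[OF m, of "F i"] by (simp add: distr_iid_coord)
  qed
  finally show ?thesis .
qed

text \<open>For bounded block functionals, Hoeffding's inequality makes the deviation probabilities
  decay geometrically in \<open>n\<close>; the Borel-Cantelli lemma then gives almost sure
  convergence.\<close>

lemma strong_law_blocks:
  fixes H :: "(nat \<times> nat \<Rightarrow> 'a) \<Rightarrow> real"
  assumes H: "H \<in> borel_measurable (iid p)" and dH: "depends_on H ({..<L} \<times> UNIV)"
    and C: "\<And>\<omega>. \<bar>H \<omega>\<bar> \<le> C"
  shows "AE \<omega> in iid p. (\<lambda>n. (\<Sum>j<n. H (\<lambda>(k, i). \<omega> (j * L + k, i))) / real n) \<longlonglongrightarrow> (\<integral>\<omega>. H \<omega> \<partial>iid p)"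
proof -
  interpret prob_space "iid p :: (nat \<times> nat \<Rightarrow> 'a) measure" by (rule prob_space_iid)
  let ?P = "iid p :: (nat \<times> nat \<Rightarrow> 'a) measure"
  define X where "X j \<omega> = H (\<lambda>(k, i). \<omega> (j * L + k, i))" for j and \<omega> :: "nat \<times> nat \<Rightarrow> 'a"
  define m where "m = (\<integral>\<omega>. H \<omega> \<partial>?P)"
  \<comment> \<open>\<open>C\<close> may be 0; the extra 1 keeps the range in Hoeffding's inequality
    of positive length.\<close>
  define D where "D = C + 1"
  have C0: "C \<ge> 0" using C[of undefined] by linarith
  then have "D > 0" by (simp add: D_def)
  have Xshift: "X j = (\<lambda>\<omega>. H ((\<lambda>\<omega> z. \<omega> ((\<lambda>(k, i). (j * L + k, i)) z)) \<omega>))" for j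
    by (auto simp: X_def fun_eq_iff intro!: arg_cong[of _ _ H])
  have X[measurable]: "X j \<in> borel_measurable ?P" for j
    unfolding Xshift by (rule measurable_compose[OF measurable_reindex H])
  have EX: "expectation (X j) = m" for j
  proof -
    have "inj (\<lambda>(k, i). (j * L + k, i::nat))" by (auto simp: inj_on_def)
    from distr_iid_reindex[OF this, of p] show ?thesis
      unfolding m_def Xshift using integral_distr[OF measurable_reindex H] by metis
  qed
  have dX: "depends_on (X j) ({j * L..<j * L + L} \<times> UNIV)" for j
    unfolding depends_on_def X_def by (intro allI impI depends_onD[OF dH]) auto
  have disj: "disjoint_family (\<lambda>j. {j * L..<j * L + L} \<times> (UNIV::nat set))"
    unfolding disjoint_family_on_def
  proof (intro ballI impI)
    fix a b :: nat assume "a \<noteq> b"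
    then have "a * L + L \<le> b * L \<or> b * L + L \<le> a * L"
      by (metis add.commute linorder_neqE_nat mult_Suc mult_le_mono1 Suc_leI)
    then show "({a * L..<a * L + L} \<times> UNIV) \<inter> ({b * L..<b * L + L} \<times> (UNIV :: nat set)) = {}"
      by auto
  qed
  have ind: "indep_vars (\<lambda>_. borel) X UNIV"
    by (rule indep_vars_blocks[OF X dX disj])
  have bound: "prob {\<omega>. \<bar>(\<Sum>j<n. X j \<omega>) - real n * m\<bar> \<ge> real n * e} \<le> 2 * exp (- (e\<^sup>2 / (2 * D\<^sup>2))) ^ n"
    if "e > 0" "n > 0" for e n
  proof -
    interpret h: Hoeffding_ineq ?P "{..<n}" X "\<lambda>_. - D" "\<lambda>_. D" "\<Sum>i<n. expectation (X i)"
    proof unfold_locales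
      show "AE x in ?P. X i x \<in> {- D..D}" if "i \<in> {..<n}" for i
      proof (rule AE_I2)
        fix x
        have "\<bar>X i x\<bar> \<le> C" unfolding X_def by (rule C)
        then show "X i x \<in> {- D..D}" by (auto simp: D_def)
      qed
    qed (auto intro: indep_vars_subset[OF ind])
    have "prob {\<omega> \<in> space ?P. \<bar>(\<Sum>j<n. X j \<omega>) - (\<Sum>i<n. expectation (X i))\<bar> \<ge> real n * e}
        \<le> 2 * exp (- 2 * (real n * e)\<^sup>2 / (\<Sum>i<n. (D - - D)\<^sup>2))"
      by (rule h.Hoeffding_ineq_abs_ge) (use that \<open>D > 0\<close> in auto)
    also have "- 2 * (real n * e)\<^sup>2 / (\<Sum>i<n. (D - - D)\<^sup>2) = real n * (- (e\<^sup>2 / (2 * D\<^sup>2)))"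
      using that \<open>D > 0\<close> by (simp add: field_simps power2_eq_square)
    also have "exp (real n * (- (e\<^sup>2 / (2 * D\<^sup>2)))) = exp (- (e\<^sup>2 / (2 * D\<^sup>2))) ^ n"
      by (rule exp_of_nat_mult)
    finally show ?thesis by (simp add: EX)
  qed
  have ev: "AE \<omega> in ?P. \<forall>\<^sub>F n in sequentially. \<bar>(\<Sum>j<n. X j \<omega>) / real n - m\<bar> < e" if "e > 0" for e
  proof -
    let ?A = "\<lambda>n. {\<omega>. \<bar>(\<Sum>j<n. X j \<omega>) - real n * m\<bar> \<ge> real n * e}"
    have "summable (\<lambda>n. 2 * exp (- (e\<^sup>2 / (2 * D\<^sup>2))) ^ n)"
      using that \<open>D > 0\<close> by (intro summable_mult summable_geometric) auto
    then have "summable (\<lambda>n. prob (?A n))"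
      by (rule summable_comparison_test_ev[rotated])
         (use bound[OF that] in \<open>auto intro!: eventually_sequentiallyI[of 1]\<close>)
    moreover have "?A n \<in> events" for n
      using measurable_sets[of "\<lambda>\<omega>. \<bar>(\<Sum>j<n. X j \<omega>) - real n * m\<bar>" ?P borel "{real n * e..}"]
      by (simp add: vimage_def)
    ultimately have "AE \<omega> in ?P. \<forall>\<^sub>F n in sequentially. \<omega> \<in> space ?P - ?A n"
      by (intro borel_cantelli_AE1) (auto simp: emeasure_eq_measure)
    then show ?thesis
    proof eventually_elim
      case (elim \<omega>)
      then show ?case using eventually_gt_at_top[of 0]
        by eventually_elim (auto simp: field_simps abs_if not_le split: if_splits)
    qed
  qed
  \<comment> \<open>Only the tolerances \<open>1 / (real q + 1)\<close> are used, so that countably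
    many null sets are discarded.\<close>
  have "AE \<omega> in ?P. \<forall>q::nat. \<forall>\<^sub>F n in sequentially. \<bar>(\<Sum>j<n. X j \<omega>) / real n - m\<bar> < 1 / (real q + 1)"
    unfolding AE_all_countable by (intro allI ev) auto
  then show ?thesis
  proof eventually_elim
    case (elim \<omega>)
    have "(\<lambda>n. (\<Sum>j<n. X j \<omega>) / real n) \<longlonglongrightarrow> m"
    proof (rule tendstoI)
      fix e :: real assume "e > 0"
      then obtain q where q: "1 / (real q + 1) < e"
        using nat_approx_posE by (metis of_nat_Suc add.commute)
      from elim have "\<forall>\<^sub>F n in sequentially. \<bar>(\<Sum>j<n. X j \<omega>) / real n - m\<bar> < 1 / (real q + 1)" by blast
      then show "\<forall>\<^sub>F n in sequentially. dist ((\<Sum>j<n. X j \<omega>) / real n) m < e"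
        by eventually_elim (use q in \<open>auto simp: dist_real_def\<close>)
    qed
    then show ?case by (simp add: X_def m_def)
  qed
qed

section \<open>One step of the particle system\<close>

definition children :: "(nat \<Rightarrow> nat \<times> nat) \<Rightarrow> int list \<Rightarrow> int list" where
  "children \<rho> zs = concat (map (\<lambda>i. offspring (\<rho> i) (zs ! i)) [0..<length zs])"

definition step :: "nat \<Rightarrow> (nat \<Rightarrow> nat \<times> nat) \<Rightarrow> int list \<Rightarrow> int list" where
  "step N \<rho> zs = rightmost N (children \<rho> zs)"

definition front :: "int list \<Rightarrow> int" where
  "front zs = Max (set zs)"

definition sites :: "int list \<Rightarrow> int \<Rightarrow> nat set" where
  "sites zs l = {i. i < length zs \<and> zs ! i = l}"

text \<open>\<open>movers\<close> and \<open>followers\<close> are the numbers of children, before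
  selection, one site ahead of the front and at the old front. A step acts on the top two sites
  through these two counts.\<close>

definition movers :: "(nat \<Rightarrow> nat \<times> nat) \<Rightarrow> int list \<Rightarrow> nat" where
  "movers \<rho> zs = (\<Sum>i\<in>sites zs (front zs). fst (\<rho> i))"

definition followers :: "(nat \<Rightarrow> nat \<times> nat) \<Rightarrow> int list \<Rightarrow> nat" where
  "followers \<rho> zs = (\<Sum>i\<in>sites zs (front zs). snd (\<rho> i)) + (\<Sum>i\<in>sites zs (front zs - 1). fst (\<rho> i))"

definition lead :: "int list \<Rightarrow> nat" where
  "lead zs = count_list zs (front zs)"

definition second :: "int list \<Rightarrow> nat" where
  "second zs = count_list zs (front zs - 1)"

lemma finite_sites [simp]: "finite (sites zs l)"
  by (simp add: sites_def)

lemma card_sites: "card (sites zs l) = count_list zs l"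
proof -
  have "card {i. i < length zs \<and> zs ! i = l} = count_list zs l"
    by (simp add: count_list_eq_length_filter length_filter_conv_card eq_commute)
  then show ?thesis by (simp add: sites_def)
qed

lemma count_list_replicate: "count_list (replicate n x) y = (if x = y then n else 0)"
  by (induction n) auto

lemma count_offspring:
  "count_list (offspring x z) l = (if z = l - 1 then fst x else 0) + (if z = l then snd x else 0)"
  by (auto simp: offspring_def count_list_replicate)

lemma count_concat: "count_list (concat xss) l = (\<Sum>xs\<leftarrow>xss. count_list xs l)"
  by (induction xss) auto

lemma count_children:
  "count_list (children \<rho> zs) l = (\<Sum>i\<in>sites zs (l - 1). fst (\<rho> i)) + (\<Sum>i\<in>sites zs l. snd (\<rho> i))"
proof -
  have "count_list (children \<rho> zs) l = (\<Sum>i<length zs. count_list (offspring (\<rho> i) (zs ! i)) l)"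
    by (simp add: children_def count_concat o_def interv_sum_list_conv_sum_set_nat atLeast0LessThan)
  also have "\<dots> = (\<Sum>i<length zs. if zs ! i = l - 1 then fst (\<rho> i) else 0)
      + (\<Sum>i<length zs. if zs ! i = l then snd (\<rho> i) else 0)"
    by (simp add: count_offspring sum.distrib)
  also have "(\<Sum>i<length zs. if zs ! i = l - 1 then fst (\<rho> i) else 0) = (\<Sum>i\<in>sites zs (l - 1). fst (\<rho> i))"
    by (subst sum.inter_filter[symmetric]) (auto simp: sites_def intro!: sum.cong)
  also have "(\<Sum>i<length zs. if zs ! i = l then snd (\<rho> i) else 0) = (\<Sum>i\<in>sites zs l. snd (\<rho> i))"
    by (subst sum.inter_filter[symmetric]) (auto simp: sites_def intro!: sum.cong)
  finally show ?thesis .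
qed

lemma length_children: "length (children \<rho> zs) = (\<Sum>i<length zs. fst (\<rho> i) + snd (\<rho> i))"
  by (simp add: children_def length_concat o_def interv_sum_list_conv_sum_set_nat atLeast0LessThan
      offspring_def)

lemma le_front: "z \<in> set zs \<Longrightarrow> z \<le> front zs"
  by (simp add: front_def)

lemma front_in: "zs \<noteq> [] \<Longrightarrow> front zs \<in> set zs"
  by (simp add: front_def)

lemma front_eqI: "m \<in> set zs \<Longrightarrow> (\<And>z. z \<in> set zs \<Longrightarrow> z \<le> m) \<Longrightarrow> front zs = m"
  unfolding front_def by (rule Max_eqI) auto

lemma count_list_pos_iff: "0 < count_list zs x \<longleftrightarrow> x \<in> set zs"
  using count_list_0_iff[of zs x] by auto

lemma children_le: "x \<in> set (children \<rho> zs) \<Longrightarrow> x \<le> front zs + 1"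
proof -
  assume "x \<in> set (children \<rho> zs)"
  then obtain i where "i < length zs" "x = zs ! i + 1 \<or> x = zs ! i"
    by (auto simp: children_def offspring_def split: if_splits)
  then show ?thesis using le_front[of "zs ! i" zs] by auto
qed

lemma descending_split:
  fixes ds :: "int list"
  assumes "sorted_wrt (\<ge>) ds" "\<And>x. x \<in> set ds \<Longrightarrow> x \<le> m"
  shows "ds = replicate (count_list ds m) m @ filter (\<lambda>x. x \<le> m - 1) ds"
  using assms
proof (induction ds)
  case (Cons a ds)
  show ?case
  proof (cases "a = m")
    case True
    then show ?thesis using Cons by simp
  next
    case False
    with Cons.prems have *: "\<And>x. x \<in> set (a # ds) \<Longrightarrow> x \<le> m - 1" by force
    then have "count_list (a # ds) m = 0" by (force simp: count_list_0_iff)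
    moreover have "filter (\<lambda>x. x \<le> m - 1) (a # ds) = a # ds" using * by (auto simp: filter_id_conv)
    ultimately show ?thesis by simp
  qed
qed simp

text \<open>In a descending list the copies of \<open>m\<close> come first and those of
  \<open>m - 1\<close> next, so the selection fills the top site and leaves the remaining room to
  the site below.\<close>

lemma count_take_descending:
  fixes ds :: "int list"
  assumes "sorted_wrt (\<ge>) ds" "\<And>x. x \<in> set ds \<Longrightarrow> x \<le> m"
  shows "count_list (take N ds) m = min N (count_list ds m)"
    and "count_list (take N ds) (m - 1) = min (N - count_list ds m) (count_list ds (m - 1))"
proof -
  define es where "es = filter (\<lambda>x. x \<le> m - 1) ds"
  define fs where "fs = filter (\<lambda>x. x \<le> m - 1 - 1) es"
  have ds: "ds = replicate (count_list ds m) m @ es"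
    unfolding es_def by (rule descending_split[OF assms])
  have es: "es = replicate (count_list es (m - 1)) (m - 1) @ fs"
    unfolding fs_def by (rule descending_split) (use assms in \<open>auto simp: es_def sorted_wrt_filter\<close>)
  have c: "count_list ds (m - 1) = count_list es (m - 1)"
    by (subst ds) (simp add: count_list_replicate)
  have fs: "count_list (take k fs) m = 0" "count_list (take k fs) (m - 1) = 0" for k
    by (auto simp: fs_def count_list_0_iff dest!: in_set_takeD)
  have "take N ds = replicate (min N (count_list ds m)) m @
      replicate (min (N - count_list ds m) (count_list ds (m - 1))) (m - 1) @
      take (N - count_list ds m - count_list es (m - 1)) fs"
    unfolding c by (subst ds, subst es) (simp add: take_replicate)
  then show "count_list (take N ds) m = min N (count_list ds m)"
    "count_list (take N ds) (m - 1) = min (N - count_list ds m) (count_list ds (m - 1))"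
    by (simp_all add: count_list_replicate fs)
qed

lemma count_list_mset_cong: "mset xs = mset ys \<Longrightarrow> count_list xs x = count_list ys x"
  by (metis count_mset)

lemma count_rightmost:
  assumes "\<And>x. x \<in> set cs \<Longrightarrow> x \<le> m"
  shows "count_list (rightmost N cs) m = min N (count_list cs m)"
    and "count_list (rightmost N cs) (m - 1) = min (N - count_list cs m) (count_list cs (m - 1))"
proof -
  have s: "sorted_wrt (\<ge>) (rev (sort cs))" by (simp add: sorted_wrt_rev)
  have c: "count_list (rev (sort cs)) x = count_list cs x" for x
    by (rule count_list_mset_cong) (simp only: mset_rev mset_sort)
  show "count_list (rightmost N cs) m = min N (count_list cs m)"
    "count_list (rightmost N cs) (m - 1) = min (N - count_list cs m) (count_list cs (m - 1))"
    using count_take_descending[OF s, of m N] assms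
    by (simp_all only: rightmost_def c set_rev set_sort)
qed

lemma set_step_subset: "set (step N \<rho> zs) \<subseteq> set (children \<rho> zs)"
  by (auto simp: step_def rightmost_def dest: in_set_takeD)

section \<open>One step from a configuration of N particles: the front advances or fails\<close>

context
  fixes N :: nat and \<rho> :: "nat \<Rightarrow> nat \<times> nat" and zs :: "int list"
  assumes valid: "\<And>i. i < N \<Longrightarrow> 1 \<le> fst (\<rho> i) + snd (\<rho> i)"
    and len: "length zs = N" and N: "0 < N"
begin

lemma length_step: "length (step N \<rho> zs) = N"
proof -
  have "N = (\<Sum>i<N. 1)" by simp
  also have "\<dots> \<le> (\<Sum>i<length zs. fst (\<rho> i) + snd (\<rho> i))"
    unfolding len by (rule sum_mono) (use valid in auto)
  finally show ?thesis by (simp add: step_def rightmost_def length_children)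
qed

lemma lead_pos: "1 \<le> lead zs"
proof -
  have "zs \<noteq> []" using len N by auto
  then have "0 < lead zs" unfolding lead_def count_list_pos_iff by (rule front_in)
  then show ?thesis by simp
qed

text \<open>No particle lies beyond the front, so the site ahead receives children of leaders only,
  and the old front becomes the second site.\<close>

lemma step_success:
  assumes "movers \<rho> zs > 0"
  shows "front (step N \<rho> zs) = front zs + 1"
    and "lead (step N \<rho> zs) = min N (movers \<rho> zs)"
    and "second (step N \<rho> zs) = min (N - movers \<rho> zs) (followers \<rho> zs)"
proof -
  have e: "sites zs (front zs + 1) = {}" by (auto simp: sites_def dest!: nth_mem le_front)
  have c1: "count_list (children \<rho> zs) (front zs + 1) = movers \<rho> zs"
    by (simp add: count_children movers_def e)
  have c2: "count_list (children \<rho> zs) (front zs) = followers \<rho> zs"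
    by (simp add: count_children followers_def)
  note r = count_rightmost[of "children \<rho> zs" "front zs + 1" N, OF children_le, simplified c1 c2 add_diff_cancel_right',
      folded step_def]
  show t: "front (step N \<rho> zs) = front zs + 1"
  proof (rule front_eqI)
    show "front zs + 1 \<in> set (step N \<rho> zs)"
      using r(1) assms N by (simp flip: count_list_pos_iff)
  qed (use set_step_subset children_le in blast)
  show "lead (step N \<rho> zs) = min N (movers \<rho> zs)"
    unfolding lead_def t using r(1) by simp
  show "second (step N \<rho> zs) = min (N - movers \<rho> zs) (followers \<rho> zs)"
    unfolding second_def t using r(2) by simp
qed

text \<open>A leader without a child to its right keeps a child in place.\<close>

lemma followers_ge:
  assumes "movers \<rho> zs = 0"
  shows "lead zs \<le> followers \<rho> zs"
proof -
  have "lead zs = (\<Sum>i\<in>sites zs (front zs). 1)" by (simp add: lead_def card_sites)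
  also have "\<dots> \<le> (\<Sum>i\<in>sites zs (front zs). snd (\<rho> i))"
  proof (rule sum_mono)
    fix i assume i: "i \<in> sites zs (front zs)"
    then have "fst (\<rho> i) = 0" using assms by (simp add: movers_def)
    moreover have "i < N" using i len by (simp add: sites_def)
    ultimately show "1 \<le> snd (\<rho> i)" using valid[of i] by simp
  qed
  also have "\<dots> \<le> followers \<rho> zs" by (simp add: followers_def)
  finally show ?thesis .
qed

text \<open>The site ahead stays empty, and by \<open>followers_ge\<close> and
  \<open>lead_pos\<close> the old front stays occupied even after selection.\<close>

lemma step_failure:
  assumes "movers \<rho> zs = 0"
  shows "front (step N \<rho> zs) = front zs"
    and "lead (step N \<rho> zs) = min N (followers \<rho> zs)"
proof -
  have e: "sites zs (front zs + 1) = {}" by (auto simp: sites_def dest!: nth_mem le_front)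
  have c1: "count_list (children \<rho> zs) (front zs + 1) = 0"
    using assms by (simp add: count_children movers_def e)
  have c2: "count_list (children \<rho> zs) (front zs) = followers \<rho> zs"
    by (simp add: count_children followers_def)
  have le: "x \<le> front zs" if "x \<in> set (children \<rho> zs)" for x
    using children_le[OF that] c1 that by (cases "x = front zs + 1") (auto simp: count_list_0_iff)
  note r = count_rightmost[of "children \<rho> zs" "front zs" N, OF le, simplified c2, folded step_def]
  show t: "front (step N \<rho> zs) = front zs"
  proof (rule front_eqI)
    show "front zs \<in> set (step N \<rho> zs)"
      using r(1) followers_ge[OF assms] lead_pos N by (simp flip: count_list_pos_iff)
  qed (use set_step_subset le in blast)
  show "lead (step N \<rho> zs) = min N (followers \<rho> zs)"
    unfolding lead_def t using r(1) by simp
qed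

lemma front_step: "front (step N \<rho> zs) = front zs + (if movers \<rho> zs = 0 then 0 else 1)"
  using step_success(1) step_failure(1) by auto

text \<open>The leaders at least double, and there is at least one of them.\<close>

lemma lead_step_ge_of_good:
  assumes "\<And>i. i < N \<Longrightarrow> 2 \<le> fst (\<rho> i)"
  shows "min N (lead zs + 1) \<le> lead (step N \<rho> zs)"
proof -
  have "2 * lead zs = (\<Sum>i\<in>sites zs (front zs). 2)" by (simp add: lead_def card_sites)
  also have "\<dots> \<le> movers \<rho> zs"
    unfolding movers_def by (rule sum_mono) (use assms len in \<open>auto simp: sites_def\<close>)
  finally show ?thesis using lead_pos step_success(2) by auto
qed

end

lemma lead_eq_length_imp_replicate:
  assumes "lead zs = length zs"
  shows "zs = replicate (length zs) (front zs)"
proof -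
  have "length (filter ((=) (front zs)) zs) = length zs"
    using assms by (simp add: lead_def count_list_eq_length_filter)
  then have "x = front zs" if "x \<in> set zs" for x
    using length_filter_less[OF that, of "(=) (front zs)"] by (cases "x = front zs") auto
  then have "replicate (length zs) (front zs) = zs"
    by (intro replicate_length_same) blast
  then show ?thesis by (rule sym)
qed

lemma lead_le_length: "lead zs \<le> length zs"
  by (simp add: lead_def count_le_length)

lemma children_map_add: "children \<rho> (map (\<lambda>z. z + c) zs) = map (\<lambda>z. z + c) (children \<rho> zs)"
  unfolding children_def map_concat map_map o_def length_map
  by (intro arg_cong[of _ _ concat] map_cong) (simp_all add: offspring_def)

lemma sort_map_add: "sort (map (\<lambda>z. z + c) zs) = map (\<lambda>z. z + (c::int)) (sort zs)"
  by (rule properties_for_sort) (simp_all add: sorted_wrt_map)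

lemma step_map_add: "step N \<rho> (map (\<lambda>z. z + c) zs) = map (\<lambda>z. z + c) (step N \<rho> zs)"
  by (simp add: step_def rightmost_def children_map_add sort_map_add rev_map take_map)

lemma front_map_add: "zs \<noteq> [] \<Longrightarrow> front (map (\<lambda>z. z + c) zs) = front zs + c"
  by (rule front_eqI) (auto simp: le_front front_in)

section \<open>Runs from an arbitrary configuration, and windows that gather all particles\<close>

primrec run :: "nat \<Rightarrow> (nat \<times> nat \<Rightarrow> nat \<times> nat) \<Rightarrow> int list \<Rightarrow> nat \<Rightarrow> int list" where
  "run N \<omega> zs 0 = zs"
| "run N \<omega> zs (Suc k) = step N (\<lambda>i. \<omega> (k, i)) (run N \<omega> zs k)"

lemma particles_eq_run: "particles N \<omega> k = run N \<omega> (replicate N 0) k"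
  by (induction k) (simp_all add: step_def children_def)

definition shift :: "nat \<Rightarrow> (nat \<times> nat \<Rightarrow> 'a) \<Rightarrow> nat \<times> nat \<Rightarrow> 'a" where
  "shift j \<omega> = (\<lambda>(k, i). \<omega> (j + k, i))"

text \<open>This cuts a long run into blocks, each driven by its own shifted samples.\<close>

lemma run_add: "run N \<omega> zs (j + k) = run N (shift j \<omega>) (run N \<omega> zs j) k"
  by (induction k) (simp_all add: shift_def)

lemma run_map_add: "run N \<omega> (map (\<lambda>z. z + c) zs) k = map (\<lambda>z. z + c) (run N \<omega> zs k)"
  by (induction k) (simp_all add: step_map_add)

definition valid_array :: "(nat \<times> nat \<Rightarrow> nat \<times> nat) \<Rightarrow> bool" where
  "valid_array \<omega> \<longleftrightarrow> (\<forall>z. 1 \<le> fst (\<omega> z) + snd (\<omega> z))"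

lemma valid_shift: "valid_array \<omega> \<Longrightarrow> valid_array (shift j \<omega>)"
  by (simp add: valid_array_def shift_def split: prod.split)

text \<open>In such a window the leaders gain at least one member per step until they are all
  \<open>N\<close> particles, so \<open>N\<close> rows suffice. The condition involves the samples
  only and not the configuration, so disjoint windows are good independently of each other.\<close>

definition good_window :: "nat \<Rightarrow> nat \<Rightarrow> (nat \<times> nat \<Rightarrow> nat \<times> nat) \<Rightarrow> bool" where
  "good_window N t \<omega> \<longleftrightarrow> (\<forall>k\<in>{t..<t + N}. \<forall>i<N. 2 \<le> fst (\<omega> (k, i)))"

context
  fixes N :: nat and \<omega> :: "nat \<times> nat \<Rightarrow> nat \<times> nat"
  assumes valid: "valid_array \<omega>" and N: "0 < N"
begin

lemma valid_row: "1 \<le> fst (\<omega> (k, i)) + snd (\<omega> (k, i))"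
  using valid by (simp add: valid_array_def)

lemma length_run:
  assumes "length zs = N"
  shows "length (run N \<omega> zs k) = N"
proof (induction k)
  case (Suc k)
  then show ?case
    unfolding run.simps by (rule length_step[OF valid_row _ N])
qed (simp add: assms)

lemma front_run_Suc:
  assumes "length zs = N"
  shows "front (run N \<omega> zs (Suc k)) = front (run N \<omega> zs k) +
    (if movers (\<lambda>i. \<omega> (k, i)) (run N \<omega> zs k) = 0 then 0 else 1)"
  unfolding run.simps by (rule front_step[OF valid_row length_run[OF assms] N])

lemma front_run_mono:
  assumes "length zs = N" "j \<le> k"
  shows "front (run N \<omega> zs j) \<le> front (run N \<omega> zs k)"
    and "front (run N \<omega> zs k) \<le> front (run N \<omega> zs j) + (int k - int j)"
proof -
  have "front (run N \<omega> zs j) \<le> front (run N \<omega> zs k) \<and>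
      front (run N \<omega> zs k) \<le> front (run N \<omega> zs j) + (int k - int j)"
    using assms(2)
  proof (induction rule: dec_induct)
    case (step k)
    then show ?case using front_run_Suc[OF assms(1), of k] by (simp del: run.simps split: if_splits)
  qed simp
  then show "front (run N \<omega> zs j) \<le> front (run N \<omega> zs k)"
    "front (run N \<omega> zs k) \<le> front (run N \<omega> zs j) + (int k - int j)" by auto
qed

lemma front_run_bounds:
  assumes "length zs = N"
  shows "front zs \<le> front (run N \<omega> zs k)" and "front (run N \<omega> zs k) \<le> front zs + int k"
  using front_run_mono[OF assms, of 0 k] by simp_all

lemma run_replicate:
  "run N \<omega> (replicate N c) k = map (\<lambda>z. z + c) (run N \<omega> (replicate N 0) k)"
  using run_map_add[of N \<omega> c "replicate N 0" k] by simp

lemma front_run_replicate: "front (run N \<omega> (replicate N c) k) = front (run N \<omega> (replicate N 0) k) + c"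
proof -
  have "run N \<omega> (replicate N 0) k \<noteq> []" using length_run[of "replicate N 0" k] N by auto
  then show ?thesis unfolding run_replicate[of c] by (rule front_map_add)
qed

lemma run_good_window_replicate:
  assumes "length zs = N" and "good_window N t \<omega>"
  shows "run N \<omega> zs (t + N) = replicate N (front (run N \<omega> zs (t + N)))"
proof -
  have "k \<le> N \<Longrightarrow> min N (k + 1) \<le> lead (run N \<omega> zs (t + k))" for k
  proof (induction k)
    case 0
    have "1 \<le> lead (run N \<omega> zs t)"
      by (rule lead_pos[OF valid_row length_run[OF assms(1)] N])
    then show ?case by simp
  next
    case (Suc k)
    have "min N (lead (run N \<omega> zs (t + k)) + 1) \<le> lead (step N (\<lambda>i. \<omega> (t + k, i)) (run N \<omega> zs (t + k)))"
    proof (rule lead_step_ge_of_good[OF valid_row length_run[OF assms(1)] N])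
      show "2 \<le> fst (\<omega> (t + k, i))" if "i < N" for i
        using assms(2) Suc.prems that by (simp add: good_window_def)
    qed
    then have "min N (lead (run N \<omega> zs (t + k)) + 1) \<le> lead (run N \<omega> zs (t + Suc k))"
      unfolding add_Suc_right run.simps .
    moreover have "min N (k + 1) \<le> lead (run N \<omega> zs (t + k))"
      by (rule Suc.IH) (use Suc.prems in simp)
    ultimately show ?case by linarith
  qed
  from this[of N] have "N \<le> lead (run N \<omega> zs (t + N))" by simp
  moreover have l: "length (run N \<omega> zs (t + N)) = N" by (rule length_run[OF assms(1)])
  ultimately have "lead (run N \<omega> zs (t + N)) = length (run N \<omega> zs (t + N))"
    using lead_le_length[of "run N \<omega> zs (t + N)"] by simp
  from lead_eq_length_imp_replicate[OF this] show ?thesis unfolding l .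
qed

end

text \<open>A good window gathers all particles on one site whatever the configuration before it was,
  so that two runs with the same samples advance together after it.\<close>

lemma run_coupling:
  assumes valid: "valid_array \<omega>" and N: "0 < N" and zs: "length zs = N" and zs': "length zs' = N"
    and good: "good_window N t \<omega>" and "t + N \<le> L"
  shows "\<bar>(front (run N \<omega> zs L) - front zs) - (front (run N \<omega> zs' L) - front zs')\<bar> \<le> int (t + N)"
proof -
  let ?T = "t + N"
  have L: "L = ?T + (L - ?T)" using assms by simp
  \<comment> \<open>From time \<open>?T\<close> on, each run is a translate of the run from the
    origin with the same samples. The two displacements can differ only by what was gained up to
    \<open>?T\<close>.\<close>
  have "front (run N \<omega> ws L) = front (run N (shift ?T \<omega>) (replicate N 0) (L - ?T)) + front (run N \<omega> ws ?T)"
    if ws: "length ws = N" for ws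
  proof -
    have "run N \<omega> ws L = run N (shift ?T \<omega>) (replicate N (front (run N \<omega> ws ?T))) (L - ?T)"
      by (subst L, subst run_add, subst run_good_window_replicate[OF valid N ws good]) simp
    then show ?thesis
      using front_run_replicate[OF valid_shift[OF valid] N, of ?T "front (run N \<omega> ws ?T)" "L - ?T"] by metis
  qed
  from this[OF zs] this[OF zs'] show ?thesis
    using front_run_bounds[OF valid N zs, of ?T] front_run_bounds[OF valid N zs', of ?T] by linarith
qed

text \<open>Positions never become negative, so the restriction to \<open>l \<ge> 0\<close> in
  \<open>max_Y\<close> removes nothing.\<close>

lemma max_Y_eq_front:
  assumes "valid_array \<omega>" "0 < N"
  shows "max_Y N \<omega> k = front (run N \<omega> (replicate N 0) k)"
proof -
  have nonneg: "\<forall>z\<in>set (run N \<omega> (replicate N 0) k). 0 \<le> z" for k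
  proof (induction k)
    case (Suc k)
    have "0 \<le> z" if "z \<in> set (children \<rho> zs)" "\<forall>z\<in>set zs. 0 \<le> z" for z \<rho> and zs :: "int list"
    proof -
      from that(1) obtain i where "i < length zs" "z = zs ! i + 1 \<or> z = zs ! i"
        by (auto simp: children_def offspring_def split: if_splits)
      then show ?thesis using that(2) nth_mem[of i zs] by force
    qed
    from this[OF subsetD[OF set_step_subset]] show ?case using Suc by simp
  qed auto
  have "{l. l \<ge> 0 \<and> Y N \<omega> k l > 0} = set (run N \<omega> (replicate N 0) k)"
    using nonneg by (auto simp: Y_def particles_eq_run count_list_pos_iff)
  then show ?thesis by (simp add: max_Y_def front_def)
qed

section \<open>Existence of the speed\<close>

lemma measurable_map2:
  fixes f :: "'w \<Rightarrow> 'b :: countable" and g :: "'w \<Rightarrow> 'c :: countable"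
  assumes f: "f \<in> measurable M (count_space UNIV)" and g: "g \<in> measurable M (count_space UNIV)"
  shows "(\<lambda>w. h (f w) (g w)) \<in> measurable M (count_space UNIV)"
proof (rule measurable_compose_countable[where f="\<lambda>x w. h x (g w)" and g=f, OF _ f])
  show "(\<lambda>w. h x (g w)) \<in> measurable M (count_space UNIV)" for x
    by (rule measurable_compose[OF g]) simp
qed

lemma measurable_map_coords:
  fixes r :: "'w \<Rightarrow> nat \<Rightarrow> 'b :: countable"
  assumes "\<And>i. (\<lambda>w. r w i) \<in> measurable M (count_space UNIV)"
  shows "(\<lambda>w. map (r w) is) \<in> measurable M (count_space UNIV)"
proof (induction "is")
  case (Cons i "is")
  show ?case unfolding list.map by (rule measurable_map2[OF assms Cons])
qed simp

text \<open>Only the first \<open>length zs\<close> samples are read, so a step factors through a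
  finite list, that is, through a countable type; this gives its measurability.\<close>

lemma step_eq_step_nth: "step N \<rho> zs = step N (\<lambda>i. map \<rho> [0..<length zs] ! i) zs"
proof -
  have "children \<rho> zs = children (\<lambda>i. map \<rho> [0..<length zs] ! i) zs"
    unfolding children_def by (intro arg_cong[of _ _ concat] map_cong) auto
  then show ?thesis by (simp add: step_def)
qed

lemma measurable_step:
  assumes r: "\<And>i. (\<lambda>w. r w i) \<in> measurable M (count_space UNIV)"
    and X: "X \<in> measurable M (count_space UNIV)"
  shows "(\<lambda>w. step N (r w) (X w)) \<in> measurable M (count_space UNIV)"
proof (rule measurable_compose_countable[where f="\<lambda>zs w. step N (r w) zs" and g=X, OF _ X])
  fix zs
  have "(\<lambda>w. step N (\<lambda>i. map (r w) [0..<length zs] ! i) zs) \<in> measurable M (count_space UNIV)"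
    by (rule measurable_compose[OF measurable_map_coords[OF r]]) simp
  then show "(\<lambda>w. step N (r w) zs) \<in> measurable M (count_space UNIV)"
    unfolding step_eq_step_nth[symmetric] .
qed

lemma measurable_run: "(\<lambda>\<omega>. run N \<omega> zs k) \<in> measurable (iid p) (count_space UNIV)"
proof (induction k)
  case (Suc k)
  show ?case unfolding run.simps by (rule measurable_step[OF measurable_iid_coord Suc])
qed simp

lemma depends_on_run: "depends_on (\<lambda>\<omega>. run N \<omega> zs k) ({..<k} \<times> UNIV)"
proof (induction k)
  case (Suc k)
  show ?case unfolding depends_on_def
  proof (intro allI impI)
    fix \<omega> \<omega>' :: "nat \<times> nat \<Rightarrow> nat \<times> nat"
    assume a: "\<forall>i\<in>{..<Suc k} \<times> UNIV. \<omega> i = \<omega>' i"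
    have "run N \<omega> zs k = run N \<omega>' zs k" by (rule depends_onD[OF Suc]) (use a in auto)
    moreover have "(\<lambda>i. \<omega> (k, i)) = (\<lambda>i. \<omega>' (k, i))" using a by auto
    ultimately show "run N \<omega> zs (Suc k) = run N \<omega>' zs (Suc k)" unfolding run.simps by (simp only:)
  qed
qed (simp add: depends_on_def)

lemma depends_on_compose: "depends_on X J \<Longrightarrow> depends_on (\<lambda>\<omega>. f (X \<omega>)) J"
  unfolding depends_on_def by metis

lemma AE_iid_coord:
  assumes "AE x in measure_pmf p. P x"
  shows "AE \<omega> in iid p. P (\<omega> i)"
proof -
  have m: "(\<lambda>\<omega>. \<omega> i) \<in> measurable (iid p) (measure_pmf p)"
    unfolding measurable_pmf_measure2 by (rule measurable_iid_coord)
  show ?thesis by (rule AE_distrD[OF m]) (subst distr_iid_coord, rule assms)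
qed

lemma AE_valid_array:
  assumes "AE x in measure_pmf p. fst x + snd x \<ge> 1"
  shows "AE \<omega> in iid p. valid_array \<omega>"
  unfolding valid_array_def AE_all_countable
  by (intro allI AE_iid_coord[OF assms])

lemma good_window_shift: "good_window N t (shift s \<omega>) \<longleftrightarrow> good_window N (s + t) \<omega>"
proof
  assume a: "good_window N t (shift s \<omega>)"
  show "good_window N (s + t) \<omega>" unfolding good_window_def
  proof (intro ballI allI impI)
    fix k i assume "k \<in> {s + t..<s + t + N}" "i < N"
    then show "2 \<le> fst (\<omega> (k, i))"
      using a unfolding good_window_def shift_def by (auto dest!: bspec[of _ _ "k - s"])
  qed
qed (auto simp: good_window_def shift_def)

lemma good_window_iff: "good_window N t \<omega> \<longleftrightarrow> (\<forall>z\<in>{t..<t + N} \<times> {..<N}. 2 \<le> fst (\<omega> z))"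
  by (auto simp: good_window_def)

lemma measurable_good_window: "Measurable.pred (iid p) (good_window N t)"
proof -
  have "Measurable.pred (iid p) (\<lambda>\<omega>. \<forall>z\<in>{t..<t + N} \<times> {..<N}. 2 \<le> fst (\<omega> z))"
    by (intro pred_intros_finite measurable_compose[OF measurable_iid_coord]) auto
  then show ?thesis by (simp add: good_window_iff[abs_def])
qed

lemma depends_on_good_window: "t + N \<le> L \<Longrightarrow> depends_on (good_window N t) ({..<L} \<times> UNIV)"
  by (auto simp: depends_on_def good_window_def)

section \<open>Good windows occur almost surely\<close>

lemma prob_good_window_pos:
  assumes "measure_pmf.prob p {x. 2 \<le> fst x} > 0"
  shows "(\<integral>\<omega>. indicator {\<omega>. good_window N t \<omega>} \<omega> \<partial>iid p) > (0 :: real)"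
proof -
  have "(\<integral>\<omega>. indicator {\<omega>. good_window N t \<omega>} \<omega> \<partial>iid p) =
      (\<integral>\<omega>. (\<Prod>z\<in>{t..<t + N} \<times> {..<N}. indicator {x. 2 \<le> fst x} (\<omega> z) :: real) \<partial>iid p)"
  proof (intro Bochner_Integration.integral_cong refl)
    fix \<omega> :: "nat \<times> nat \<Rightarrow> nat \<times> nat"
    show "indicator {\<omega>. good_window N t \<omega>} \<omega> =
        (\<Prod>z\<in>{t..<t + N} \<times> {..<N}. indicator {x. 2 \<le> fst x} (\<omega> z) :: real)"
    proof (cases "good_window N t \<omega>")
      case True
      then show ?thesis by (subst prod.neutral) (auto simp: good_window_iff)
    next
      case False
      then show ?thesis by (subst prod_zero) (auto simp: good_window_iff indicator_def)
    qed
  qed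
  also have "\<dots> = (\<Prod>z\<in>{t..<t + N} \<times> {..<N}. \<integral>x. indicator {x. 2 \<le> fst x} x \<partial>measure_pmf p)"
    by (rule expectation_prod_iid[where C=1]) auto
  also have "\<dots> > 0" using assms by (intro prod_pos) auto
  finally show ?thesis .
qed

text \<open>By the strong law for disjoint windows, the good ones have a positive limiting
  frequency, so at least one occurs.\<close>

lemma AE_exists_good_window:
  assumes "measure_pmf.prob p {x. 2 \<le> fst x} > 0"
  shows "AE \<omega> in iid p. \<exists>t. good_window N t \<omega>"
proof -
  let ?H = "\<lambda>\<omega>. indicator {\<omega>. good_window N 0 \<omega>} \<omega> :: real"
  have m: "?H \<in> borel_measurable (iid p)"
    using measurable_good_window[where N=N and t=0] by (intro borel_measurable_indicator) (simp add: pred_def)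
  have "depends_on ?H ({..<N} \<times> UNIV)"
    using depends_on_good_window[of 0 N N] unfolding depends_on_def indicator_def by auto
  then have "AE \<omega> in iid p. (\<lambda>n. (\<Sum>j<n. ?H (\<lambda>(k, i). \<omega> (j * N + k, i))) / real n)
      \<longlonglongrightarrow> (\<integral>\<omega>. ?H \<omega> \<partial>iid p)"
    by (intro strong_law_blocks[where C=1] m) auto
  then show ?thesis
  proof eventually_elim
    case (elim \<omega>)
    show ?case
    proof (rule ccontr)
      assume "\<nexists>t. good_window N t \<omega>"
      then have "?H (\<lambda>(k, i). \<omega> (j * N + k, i)) = 0" for j
        using good_window_shift[of N 0 "j * N" \<omega>] by (simp add: shift_def)
      then have "(\<lambda>n. 0) \<longlonglongrightarrow> (\<integral>\<omega>. ?H \<omega> \<partial>iid p)" using elim by simp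
      then have "(\<integral>\<omega>. ?H \<omega> \<partial>iid p) = 0" using LIMSEQ_unique tendsto_const by metis
      then show False using prob_good_window_pos[OF assms, of N 0] by linarith
    qed
  qed
qed

lemma prob_no_good_window_tendsto:
  assumes "measure_pmf.prob p {x. 2 \<le> fst x} > 0"
  shows "(\<lambda>K. measure (iid p) {\<omega>. \<forall>t<K. \<not> good_window N t \<omega>}) \<longlonglongrightarrow> 0"
proof -
  interpret prob_space "iid p :: (nat \<times> nat \<Rightarrow> nat \<times> nat) measure" by (rule prob_space_iid)
  let ?A = "\<lambda>K. {\<omega>. \<forall>t<K. \<not> good_window N t \<omega>}"
  have meas: "?A K \<in> sets (iid p)" for K
  proof -
    have "Measurable.pred (iid p) (\<lambda>\<omega>. \<forall>t\<in>{..<K}. \<not> good_window N t \<omega>)"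
      by (intro pred_intros_finite pred_intros_logic measurable_good_window) auto
    then show ?thesis by (simp add: pred_def Ball_def)
  qed
  have "(\<lambda>K. measure (iid p) (?A K)) \<longlonglongrightarrow> measure (iid p) (\<Inter>K. ?A K)"
    by (rule finite_Lim_measure_decseq) (use meas in \<open>auto simp: decseq_def\<close>)
  moreover have "measure (iid p) (\<Inter>K. ?A K) = 0"
  proof -
    have "AE \<omega> in iid p. \<omega> \<notin> (\<Inter>K. ?A K)"
      using AE_exists_good_window[OF assms, of N] by eventually_elim auto
    moreover have "(\<Inter>K. ?A K) \<in> sets (iid p)" using meas by (intro sets.countable_INT) auto
    ultimately show ?thesis by (simp add: prob_eq_0)
  qed
  ultimately show ?thesis by simp
qed

text \<open>The price of restarting a block of length \<open>L\<close> from one site. A good window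
  that starts before \<open>K\<close> is over by time \<open>K + N\<close> and limits the
  discrepancy to that time; otherwise the trivial bound \<open>L\<close> remains.\<close>

definition coupling_bound :: "nat \<Rightarrow> nat \<Rightarrow> nat \<Rightarrow> (nat \<times> nat \<Rightarrow> nat \<times> nat) \<Rightarrow> real" where
  "coupling_bound N K L \<omega> = (if \<exists>t<K. good_window N t \<omega> then real (K + N) else real L)"

lemma coupling_bound:
  assumes valid: "valid_array \<omega>" and N: "0 < N" and zs: "length zs = N" and "K + N \<le> L"
  shows "\<bar>real_of_int (front (run N \<omega> zs L)) - front zs - front (run N \<omega> (replicate N 0) L)\<bar>
    \<le> coupling_bound N K L \<omega>"
proof -
  have f0: "front (replicate N 0) = 0" using N by (intro front_eqI) auto
  show ?thesis
  proof (cases "\<exists>t<K. good_window N t \<omega>")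
    case True
    then obtain t where t: "t < K" "good_window N t \<omega>" by blast
    have "\<bar>(front (run N \<omega> zs L) - front zs) - (front (run N \<omega> (replicate N 0) L) - front (replicate N 0))\<bar>
        \<le> int (t + N)"
      by (rule run_coupling[OF valid N zs _ t(2)]) (use t assms(4) in auto)
    then show ?thesis using t True f0 by (simp add: coupling_bound_def)
  next
    case False
    then have C: "coupling_bound N K L \<omega> = real L" by (simp only: coupling_bound_def if_False)
    show ?thesis
      using front_run_bounds[OF valid N zs, of L] front_run_bounds[OF valid N length_replicate, of 0 L] f0
        C by linarith
  qed
qed

text \<open>At each multiple of \<open>L\<close> the true configuration is replaced by all particles
  on a single site; the errors of the blocks add up.\<close>

lemma coupling_bound_sum:
  assumes valid: "valid_array \<omega>" and N: "0 < N" and KL: "K + N \<le> L"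
  shows "\<bar>real_of_int (front (run N \<omega> (replicate N 0) (n * L))) -
      (\<Sum>j<n. real_of_int (front (run N (shift (j * L) \<omega>) (replicate N 0) L)))\<bar>
    \<le> (\<Sum>j<n. coupling_bound N K L (shift (j * L) \<omega>))"
proof (induction n)
  case 0
  have "front (replicate N 0) = 0" using N by (intro front_eqI) auto
  then show ?case by simp
next
  case (Suc n)
  let ?zs = "run N \<omega> (replicate N 0) (n * L)"
  have r: "run N \<omega> (replicate N 0) (Suc n * L) = run N (shift (n * L) \<omega>) ?zs L"
    using run_add[of N \<omega> "replicate N 0" "n * L" L] by (simp add: add.commute)
  have "length ?zs = N" by (rule length_run[OF valid N]) simp
  from coupling_bound[OF valid_shift[OF valid] N this KL, of "n * L"] Suc show ?case
    unfolding r sum.lessThan_Suc by linarith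
qed


text \<open>Clamped between 0 and \<open>L\<close> because the strong law asks for a bound at every
  sample, whereas the front is known to stay in this range only for valid arrays.\<close>

definition block_front :: "nat \<Rightarrow> nat \<Rightarrow> (nat \<times> nat \<Rightarrow> nat \<times> nat) \<Rightarrow> real" where
  "block_front N L \<omega> = max 0 (min (real L) (real_of_int (front (run N \<omega> (replicate N 0) L))))"

lemma front_run_origin:
  assumes "valid_array \<omega>" "0 < N"
  shows "0 \<le> front (run N \<omega> (replicate N 0) k)" "front (run N \<omega> (replicate N 0) k) \<le> int k"
proof -
  have "front (replicate N 0) = 0" using assms by (intro front_eqI) auto
  then show "0 \<le> front (run N \<omega> (replicate N 0) k)" "front (run N \<omega> (replicate N 0) k) \<le> int k"
    using front_run_bounds[OF assms length_replicate, of 0 k] by auto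
qed

lemma block_front_eq:
  assumes "valid_array \<omega>" "0 < N"
  shows "block_front N L \<omega> = real_of_int (front (run N \<omega> (replicate N 0) L))"
  using front_run_origin[OF assms, of L] by (simp add: block_front_def)

lemma measurable_block_front: "block_front N L \<in> borel_measurable (iid p)"
proof -
  have "(\<lambda>\<omega>. (\<lambda>zs. max 0 (min (real L) (real_of_int (front zs)))) (run N \<omega> (replicate N 0) L)) \<in> borel_measurable (iid p)"
    by (rule measurable_compose[OF measurable_run]) simp
  then show ?thesis by (simp add: block_front_def[abs_def])
qed

lemma depends_on_block_front: "depends_on (block_front N L) ({..<L} \<times> UNIV)"
  unfolding block_front_def[abs_def]
  by (rule depends_on_compose[OF depends_on_run])

lemma measurable_coupling_bound: "coupling_bound N K L \<in> borel_measurable (iid p)"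
proof -
  have "Measurable.pred (iid p) (\<lambda>\<omega>. \<exists>t\<in>{..<K}. good_window N t \<omega>)"
    by (intro pred_intros_finite measurable_good_window) auto
  then have "{\<omega> \<in> space (iid p). \<exists>t<K. good_window N t \<omega>} \<in> sets (iid p)"
    unfolding pred_def Bex_def lessThan_iff .
  then show ?thesis
    unfolding coupling_bound_def[abs_def] by (intro measurable_If measurable_const) simp_all
qed

lemma depends_on_coupling_bound:
  assumes "K + N \<le> L"
  shows "depends_on (coupling_bound N K L) ({..<L} \<times> UNIV)"
  unfolding depends_on_def
proof (intro allI impI)
  fix \<omega> \<omega>' :: "nat \<times> nat \<Rightarrow> nat \<times> nat"
  assume a: "\<forall>i\<in>{..<L} \<times> UNIV. \<omega> i = \<omega>' i"
  have "good_window N t \<omega> = good_window N t \<omega>'" if "t < K" for t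
    by (rule depends_onD[OF depends_on_good_window[of t N L]]) (use that assms a in auto)
  then show "coupling_bound N K L \<omega> = coupling_bound N K L \<omega>'"
    unfolding coupling_bound_def by metis
qed

lemma expectation_coupling_bound:
  "(\<integral>\<omega>. coupling_bound N K L \<omega> \<partial>iid p) \<le>
     real (K + N) + real L * measure (iid p) {\<omega>. \<forall>t<K. \<not> good_window N t \<omega>}"
proof -
  interpret prob_space "iid p :: (nat \<times> nat \<Rightarrow> nat \<times> nat) measure" by (rule prob_space_iid)
  let ?A = "{\<omega>. \<forall>t<K. \<not> good_window N t \<omega>}"
  have A: "?A \<in> sets (iid p)"
  proof -
    have "Measurable.pred (iid p) (\<lambda>\<omega>. \<forall>t\<in>{..<K}. \<not> good_window N t \<omega>)"
      by (intro pred_intros_finite pred_intros_logic measurable_good_window) auto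
    then show ?thesis by (simp add: pred_def Ball_def)
  qed
  have i: "integrable (iid p) (indicator ?A :: _ \<Rightarrow> real)"
    by (rule integrable_const_bound[where B=1]) (use A in \<open>simp_all add: borel_measurable_indicator\<close>)
  have "(\<integral>\<omega>. coupling_bound N K L \<omega> \<partial>iid p) \<le> (\<integral>\<omega>. real (K + N) + real L * indicator ?A \<omega> \<partial>iid p)"
  proof (rule integral_mono)
    show "integrable (iid p) (coupling_bound N K L)"
      by (rule integrable_const_bound[where B="real (K + N) + real L"])
         (simp_all add: coupling_bound_def measurable_coupling_bound)
    show "integrable (iid p) (\<lambda>\<omega>. real (K + N) + real L * indicator ?A \<omega>)"
      by (intro Bochner_Integration.integrable_add integrable_mult_right i integrable_const)
    show "coupling_bound N K L \<omega> \<le> real (K + N) + real L * indicator ?A \<omega>" for \<omega>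
      by (cases "\<exists>t<K. good_window N t \<omega>") (auto simp: coupling_bound_def indicator_def)
  qed
  also have "\<dots> = (\<integral>\<omega>. real (K + N) \<partial>(iid p :: (nat \<times> nat \<Rightarrow> nat \<times> nat) measure)) + real L * (\<integral>\<omega>. indicator ?A \<omega> \<partial>iid p)"
    by (subst Bochner_Integration.integral_add) (simp_all add: i)
  also have "\<dots> = real (K + N) + real L * measure (iid p) ?A"
    using prob_space by simp
  finally show ?thesis .
qed

lemma shift_conv: "shift (j * L) \<omega> = (\<lambda>(k, i). \<omega> (j * L + k, i))"
  by (simp add: shift_def)

section \<open>From block averages to the almost sure speed\<close>

context
  fixes p :: "(nat \<times> nat) pmf" and N :: nat
  assumes valid: "AE x in measure_pmf p. fst x + snd x \<ge> 1"
    and branching: "measure_pmf.prob p {x. 2 \<le> fst x} > 0"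
    and N: "0 < N"
begin

lemma block_speed_approx:
  fixes e :: real
  assumes "e > 0"
  obtains L c where "0 < L" and "AE \<omega> in iid p. \<forall>\<^sub>F n in sequentially.
    \<bar>real_of_int (front (run N \<omega> (replicate N 0) (n * L))) / real (n * L) - c\<bar> < e"
proof -
  from prob_no_good_window_tendsto[OF branching, of N]
  have "\<forall>\<^sub>F K in sequentially. measure (iid p) {\<omega>. \<forall>t<K. \<not> good_window N t \<omega>} < e / 4"
    by (rule order_tendstoD(2)) (use assms in simp)
  then obtain K where K: "measure (iid p) {\<omega>. \<forall>t<K. \<not> good_window N t \<omega>} < e / 4"
    by (auto simp: eventually_sequentially)
  \<comment> \<open>\<open>K\<close> is fixed before \<open>L\<close>: the block is made so long
    that \<open>K + N\<close> is at most the fraction \<open>e / 4\<close> of it. Together with the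
    probability \<open>e / 4\<close> of having no window, the mean error is at most
    \<open>e / 2\<close> per unit of time.\<close>
  obtain L0 :: nat where L0: "real (K + N) / (e / 4) < real L0" using reals_Archimedean2 by blast
  define L where "L = L0 + (K + N)"
  have L: "0 < L" "K + N \<le> L" using N by (auto simp: L_def)
  have "real (K + N) < e / 4 * real L0" using L0 assms by (simp add: field_simps)
  also have "\<dots> \<le> e / 4 * real L" using assms by (intro mult_left_mono) (auto simp: L_def)
  finally have KN: "real (K + N) \<le> e / 4 * real L" by simp
  define d where "d = (\<integral>\<omega>. coupling_bound N K L \<omega> \<partial>iid p)"
  define m where "m = (\<integral>\<omega>. block_front N L \<omega> \<partial>iid p)"
  have "d \<le> real (K + N) + real L * measure (iid p) {\<omega>. \<forall>t<K. \<not> good_window N t \<omega>}"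
    unfolding d_def by (rule expectation_coupling_bound)
  also have "\<dots> \<le> real (K + N) + real L * (e / 4)"
    by (intro add_left_mono mult_left_mono less_imp_le[OF K]) simp
  finally have "d \<le> real (K + N) + real L * (e / 4)" .
  with KN have d: "d \<le> e / 2 * real L" by (simp add: field_simps)
  have S1: "AE \<omega> in iid p. (\<lambda>n. (\<Sum>j<n. block_front N L (shift (j * L) \<omega>)) / real n) \<longlonglongrightarrow> m"
    unfolding shift_conv m_def
    by (rule strong_law_blocks[OF measurable_block_front depends_on_block_front, where C="real L"])
       (auto simp: block_front_def)
  have S2: "AE \<omega> in iid p. (\<lambda>n. (\<Sum>j<n. coupling_bound N K L (shift (j * L) \<omega>)) / real n) \<longlonglongrightarrow> d"
    unfolding shift_conv d_def
    by (rule strong_law_blocks[OF measurable_coupling_bound depends_on_coupling_bound[OF L(2)],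
          where C="real (K + N) + real L"])
       (auto simp: coupling_bound_def)
  have "AE \<omega> in iid p. \<forall>\<^sub>F n in sequentially.
    \<bar>real_of_int (front (run N \<omega> (replicate N 0) (n * L))) / real (n * L) - m / real L\<bar> < e"
    using S1 S2 AE_valid_array[OF valid]
  proof eventually_elim
    case (elim \<omega>)
    have f: "block_front N L (shift (j * L) \<omega>) =
        real_of_int (front (run N (shift (j * L) \<omega>) (replicate N 0) L))" for j
      by (rule block_front_eq[OF valid_shift[OF elim(3)] N])
    have pos: "e / 8 * real L > 0" using assms L by simp
    have E1: "\<forall>\<^sub>F n in sequentially. dist ((\<Sum>j<n. block_front N L (shift (j * L) \<omega>)) / real n) m < e / 8 * real L"
      by (rule tendstoD[OF elim(1) pos])
    have E2: "\<forall>\<^sub>F n in sequentially. dist ((\<Sum>j<n. coupling_bound N K L (shift (j * L) \<omega>)) / real n) d < e / 8 * real L"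
      by (rule tendstoD[OF elim(2) pos])
    show ?case using E1 E2 eventually_gt_at_top[of 0]
    proof eventually_elim
      case (elim n)
      define F where "F = real_of_int (front (run N \<omega> (replicate N 0) (n * L)))"
      define A where "A = (\<Sum>j<n. block_front N L (shift (j * L) \<omega>))"
      define B where "B = (\<Sum>j<n. coupling_bound N K L (shift (j * L) \<omega>))"
      have "\<bar>F - A\<bar> \<le> B"
        unfolding F_def A_def B_def f by (rule coupling_bound_sum[OF \<open>valid_array \<omega>\<close> N L(2)])
      then have "\<bar>F / real n - A / real n\<bar> \<le> B / real n"
        using elim(3) by (simp add: diff_divide_distrib[symmetric] divide_right_mono)
      moreover have "\<bar>A / real n - m\<bar> < e / 8 * real L" "\<bar>B / real n - d\<bar> < e / 8 * real L"
        using elim(1,2) by (simp_all add: A_def B_def dist_real_def)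
      ultimately have "\<bar>F / real n - m\<bar> < e / 8 * real L + e / 8 * real L + e / 2 * real L"
        using d by linarith
      also have "\<dots> \<le> e * real L" using assms by (simp add: field_simps)
      finally have A: "\<bar>F / real n - m\<bar> / real L < e"
        using L(1) by (simp add: pos_divide_less_eq)
      have B: "\<bar>F / real n - m\<bar> / real L = \<bar>(F / real n - m) / real L\<bar>"
        by (simp only: abs_divide abs_of_nat)
      have C: "(F / real n - m) / real L = F / real (n * L) - m / real L"
        by (simp add: diff_divide_distrib)
      show ?case using A unfolding B C unfolding F_def .
    qed
  qed
  from that[OF L(1) this] show thesis .
qed

text \<open>Between multiples of \<open>L\<close> the front moves by less than \<open>L\<close>,
  which is negligible after division by \<open>n\<close>.\<close>

lemma speed_approx:
  fixes e :: real
  assumes "e > 0"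
  obtains c where "AE \<omega> in iid p. \<forall>\<^sub>F n in sequentially.
    \<bar>real_of_int (front (run N \<omega> (replicate N 0) n)) / real n - c\<bar> < e"
proof -
  obtain L c where L: "0 < L" and ae: "AE \<omega> in iid p. \<forall>\<^sub>F n in sequentially.
    \<bar>real_of_int (front (run N \<omega> (replicate N 0) (n * L))) / real (n * L) - c\<bar> < e / 2"
    using block_speed_approx[of "e / 2"] assms by auto
  have "AE \<omega> in iid p. \<forall>\<^sub>F n in sequentially.
    \<bar>real_of_int (front (run N \<omega> (replicate N 0) n)) / real n - c\<bar> < e"
    using ae AE_valid_array[OF valid]
  proof eventually_elim
    case (elim \<omega>)
    let ?F = "\<lambda>n. real_of_int (front (run N \<omega> (replicate N 0) n))"
    have "filterlim (\<lambda>n. n div L) sequentially sequentially"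
      using L by (intro filterlim_at_top_div_const_nat)
    from filterlim_iff[THEN iffD1, OF this, rule_format, OF elim(1)]
    have E1: "\<forall>\<^sub>F n in sequentially. \<bar>?F (n div L * L) / real (n div L * L) - c\<bar> < e / 2" .
    obtain n0 :: nat where n0: "real L / (e / 2) < real n0" using reals_Archimedean2 by blast
    show ?case using E1 eventually_ge_at_top[of n0] eventually_ge_at_top[of L]
    proof eventually_elim
      case (elim n)
      define M where "M = n div L * L"
      have nM: "M \<le> n" "n < M + L"
        unfolding M_def using div_mult_mod_eq[of n L] mod_less_divisor[OF L, of n] by linarith+
      have "n div L > 0" using elim(3) L by (simp add: div_greater_zero_iff)
      then have M0: "M > 0" using L by (simp add: M_def)
      have a: "0 \<le> ?F M" "?F M \<le> real M"
        using front_run_origin[OF \<open>valid_array \<omega>\<close> N, of M] by auto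
      have ab: "?F M \<le> ?F n" "?F n \<le> ?F M + (real n - real M)"
        using front_run_mono[OF \<open>valid_array \<omega>\<close> N length_replicate nM(1), of 0] by auto
      have n0': "n > 0" using M0 nM by simp
      \<comment> \<open>Over the common denominator, both parts of the numerator lie between 0 and
        \<open>real L * real M\<close>, hence so does the absolute value of their
        difference.\<close>
      have "?F n / real n - ?F M / real M = ((?F n - ?F M) * real M - ?F M * (real n - real M)) / (real n * real M)"
        using M0 n0' by (simp add: field_simps)
      moreover have "\<bar>(?F n - ?F M) * real M - ?F M * (real n - real M)\<bar> \<le> real L * real M"
      proof -
        have "0 \<le> (?F n - ?F M) * real M" "(?F n - ?F M) * real M \<le> real L * real M"
          using ab nM by (auto intro!: mult_right_mono)
        moreover have "0 \<le> ?F M * (real n - real M)" "?F M * (real n - real M) \<le> real M * real L"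
          using a nM by (auto intro!: mult_mono)
        ultimately show ?thesis by (simp add: mult.commute abs_le_iff)
      qed
      ultimately have "\<bar>?F n / real n - ?F M / real M\<bar> \<le> (real L * real M) / \<bar>real n * real M\<bar>"
        by (simp only: abs_divide divide_right_mono abs_ge_zero)
      also have "\<bar>real n * real M\<bar> = real n * real M" by simp
      also have "real L * real M / (real n * real M) = real L / real n" using M0 by simp
      also have "real L / real n < e / 2"
      proof -
        have "real L / (e / 2) < real n" using n0 elim(2) by linarith
        then show ?thesis using assms n0' by (simp add: field_simps)
      qed
      finally show ?case using elim(1) unfolding M_def[symmetric] by linarith
    qed
  qed
  from that[OF this] show thesis .
qed

text \<open>The approximating constants are deterministic. A single sample path that obeys all of
  them gives a Cauchy sequence; its limit is close to every \<open>c q\<close>, which forces all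
  other such paths to the same limit.\<close>

lemma ex_speed_limit:
  obtains v where "AE \<omega> in iid p.
    (\<lambda>n. real_of_int (front (run N \<omega> (replicate N 0) n)) / real n) \<longlonglongrightarrow> v"
proof -
  interpret prob_space "iid p :: (nat \<times> nat \<Rightarrow> nat \<times> nat) measure" by (rule prob_space_iid)
  let ?x = "\<lambda>\<omega> n. real_of_int (front (run N \<omega> (replicate N 0) n)) / real n"
  define r where "r q = 1 / (real q + 1)" for q :: nat
  have r: "r q > 0" for q by (simp add: r_def)
  define P where "P q c \<longleftrightarrow> (AE \<omega> in iid p. \<forall>\<^sub>F n in sequentially. \<bar>?x \<omega> n - c\<bar> < r q)" for q c
  have "\<exists>c. P q c" for q
    using speed_approx[OF r[of q]] unfolding P_def by blast
  then obtain c where c: "\<And>q. P q (c q)" by metis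
  have ae: "AE \<omega> in iid p. \<forall>q. \<forall>\<^sub>F n in sequentially. \<bar>?x \<omega> n - c q\<bar> < r q"
    unfolding AE_all_countable using c unfolding P_def by (rule allI)
  have small: "\<exists>q. r q < e" if "e > 0" for e
  proof -
    obtain n where "1 / real (Suc n) < e" using nat_approx_posE[OF \<open>e > 0\<close>] by blast
    then show ?thesis unfolding r_def by (intro exI[of _ n]) (simp add: add.commute)
  qed
  have "\<exists>\<omega>. \<forall>q. \<forall>\<^sub>F n in sequentially. \<bar>?x \<omega> n - c q\<bar> < r q"
  proof (rule ccontr)
    assume n: "\<not> (\<exists>\<omega>. \<forall>q. \<forall>\<^sub>F n in sequentially. \<bar>?x \<omega> n - c q\<bar> < r q)"
    have "AE \<omega> in (iid p :: (nat \<times> nat \<Rightarrow> nat \<times> nat) measure). False" using ae by eventually_elim (use n in blast)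
    then show False by (simp only: AE_False)
  qed
  then obtain w where w: "\<And>q. \<forall>\<^sub>F n in sequentially. \<bar>?x w n - c q\<bar> < r q" by blast
  have "Cauchy (?x w)"
  proof (rule metric_CauchyI)
    fix e :: real assume "e > 0"
    then obtain q where q: "r q < e / 2" using small[of "e / 2"] by auto
    from w[of q] obtain n0 where n0: "\<And>n. n \<ge> n0 \<Longrightarrow> \<bar>?x w n - c q\<bar> < r q"
      by (auto simp: eventually_sequentially)
    have "dist (?x w m) (?x w n) < e" if "m \<ge> n0" "n \<ge> n0" for m n
      using n0[OF that(1)] n0[OF that(2)] q unfolding dist_real_def by linarith
    then show "\<exists>M. \<forall>m\<ge>M. \<forall>n\<ge>M. dist (?x w m) (?x w n) < e" by blast
  qed
  then obtain v where v: "?x w \<longlonglongrightarrow> v" by (auto simp: Cauchy_convergent_iff convergent_def)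
  have cv: "\<bar>v - c q\<bar> \<le> r q" for q
  proof (rule tendsto_upperbound)
    show "(\<lambda>n. \<bar>?x w n - c q\<bar>) \<longlonglongrightarrow> \<bar>v - c q\<bar>" by (intro tendsto_intros v)
    show "\<forall>\<^sub>F n in sequentially. \<bar>?x w n - c q\<bar> \<le> r q" using w[of q] by eventually_elim simp
  qed simp
  have "AE \<omega> in iid p. ?x \<omega> \<longlonglongrightarrow> v"
    using ae
  proof eventually_elim
    case (elim \<omega>)
    show ?case
    proof (rule tendstoI)
      fix e :: real assume "e > 0"
      then obtain q where q: "r q < e / 2" using small[of "e / 2"] by auto
      from elim have "\<forall>\<^sub>F n in sequentially. \<bar>?x \<omega> n - c q\<bar> < r q" by blast
      then show "\<forall>\<^sub>F n in sequentially. dist (?x \<omega> n) v < e"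
        by eventually_elim (use q cv[of q] in \<open>unfold dist_real_def, linarith\<close>)
    qed
  qed
  from that[OF this] show thesis .
qed

text \<open>Dominated convergence with the bound 1 turns the almost sure limit into a limit of
  means, where failures can be counted step by step.\<close>

lemma speed_eq_limit_expectation:
  "(\<lambda>n. (\<integral>\<omega>. real_of_int (front (run N \<omega> (replicate N 0) n)) \<partial>iid p) / real n) \<longlonglongrightarrow> speed p N"
proof -
  interpret prob_space "iid p :: (nat \<times> nat \<Rightarrow> nat \<times> nat) measure" by (rule prob_space_iid)
  let ?x = "\<lambda>n \<omega>. real_of_int (front (run N \<omega> (replicate N 0) n)) / real n"
  obtain v where v: "AE \<omega> in iid p. (\<lambda>n. ?x n \<omega>) \<longlonglongrightarrow> v"
    using ex_speed_limit by blast
  have "AE \<omega> in iid p. (\<lambda>k. real_of_int (max_Y N \<omega> k) / real k) \<longlonglongrightarrow> v"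
    using v AE_valid_array[OF valid] by eventually_elim (simp add: max_Y_eq_front N)
  then have "speed p N = v" unfolding iid_array_eq_iid[symmetric] by (rule speed_eqI)
  moreover have "(\<lambda>n. \<integral>\<omega>. ?x n \<omega> \<partial>iid p) \<longlonglongrightarrow> (\<integral>\<omega>. v \<partial>(iid p :: (nat \<times> nat \<Rightarrow> nat \<times> nat) measure))"
  proof (rule integral_dominated_convergence[where w="\<lambda>_. 1"])
    show "?x n \<in> borel_measurable (iid p)" for n
      by (rule measurable_compose[OF measurable_run, where g="\<lambda>zs. real_of_int (front zs) / real n"]) simp
    show "AE \<omega> in iid p. norm (?x n \<omega>) \<le> 1" for n
      using AE_valid_array[OF valid]
    proof eventually_elim
      case (elim \<omega>)
      have "real_of_int (front (run N \<omega> (replicate N 0) n)) \<le> real n"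
        "0 \<le> real_of_int (front (run N \<omega> (replicate N 0) n))"
        using front_run_origin[OF elim N, of n] by auto
      then show ?case by (cases "n = 0") (simp_all add: divide_le_eq)
    qed
  qed (use v in auto)
  ultimately show ?thesis using prob_space by simp
qed

end

section \<open>The extinction probability\<close>

definition pgf :: "nat pmf \<Rightarrow> real \<Rightarrow> real" where
  "pgf r s = (\<integral>x. s ^ x \<partial>measure_pmf r)"

lemma integrable_power_pmf:
  fixes f :: "'a \<Rightarrow> nat"
  assumes "0 \<le> s" "s \<le> 1"
  shows "integrable (measure_pmf r) (\<lambda>x. (s :: real) ^ f x)"
  by (rule measure_pmf.integrable_const_bound[where B=1]) (use assms in \<open>auto simp: power_le_one\<close>)

lemma pgf_nonneg: "0 \<le> s \<Longrightarrow> 0 \<le> pgf r s"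
  by (simp add: pgf_def)

lemma pgf_mono: "0 \<le> s \<Longrightarrow> s \<le> t \<Longrightarrow> t \<le> 1 \<Longrightarrow> pgf r s \<le> pgf r t"
  unfolding pgf_def by (intro integral_mono integrable_power_pmf) (auto intro: power_mono)

lemma pgf_1: "pgf r 1 = 1"
  by (simp add: pgf_def)

lemma pgf_le_1: "0 \<le> s \<Longrightarrow> s \<le> 1 \<Longrightarrow> pgf r s \<le> 1"
  using pgf_mono[of s 1 r] by (simp add: pgf_1)

lemma pgf_0: "pgf r 0 = pmf r 0"
proof -
  have "pgf r 0 = (\<integral>x. indicator {0} x \<partial>measure_pmf r)"
    unfolding pgf_def by (intro Bochner_Integration.integral_cong refl) (auto simp: indicator_def)
  then show ?thesis by (simp add: measure_pmf_single)
qed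

lemma pgf_tendsto:
  assumes "\<And>n. 0 \<le> s n" "\<And>n. s n \<le> 1" "s \<longlonglongrightarrow> t"
  shows "(\<lambda>n. pgf r (s n)) \<longlonglongrightarrow> pgf r t"
  unfolding pgf_def
proof (rule integral_dominated_convergence[where w="\<lambda>_. 1"])
  show "AE x in measure_pmf r. (\<lambda>n. s n ^ x) \<longlonglongrightarrow> t ^ x"
    by (intro AE_I2 tendsto_intros assms)
  show "AE x in measure_pmf r. norm (s n ^ x) \<le> 1" for n
    by (intro AE_I2) (use assms in \<open>auto simp: power_le_one\<close>)
qed auto

text \<open>Since \<open>1 - a ^ x = (1 - a) * (\<Sum>j<x. a ^ j)\<close>, the inequality
  \<open>pgf r a < a\<close> says that the geometric sum has mean greater than 1. These sums
  increase to \<open>x\<close> as \<open>a\<close> tends to 1, so monotone convergence also covers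
  an infinite mean.\<close>

lemma ex_pgf_less:
  assumes mean: "(\<integral>\<^sup>+x. of_nat x \<partial>measure_pmf r) > 1" and "t < 1"
  obtains s where "t < s" "0 < s" "s < 1" "pgf r s < s"
proof -
  \<comment> \<open>The shift by 2 keeps \<open>a 0\<close> positive.\<close>
  define a where "a n = 1 - 1 / (real n + 2)" for n :: nat
  have a: "0 < a n" "a n < 1" for n by (auto simp: a_def field_simps)
  define g where "g n x = (\<Sum>j<x. a n ^ j)" for n x :: nat
  have a_mono: "a m \<le> a n" if "m \<le> n" for m n
    using that by (auto simp: a_def intro!: divide_left_mono)
  have a_lim: "a \<longlonglongrightarrow> 1"
  proof -
    have "(\<lambda>n. 1 - 1 / real (n + 2)) \<longlonglongrightarrow> 1 - 0"
      by (intro tendsto_intros LIMSEQ_ignore_initial_segment lim_1_over_n)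
    then show ?thesis by (simp add: a_def[abs_def] add.commute)
  qed
  have g0: "0 \<le> g n x" for n x using a[of n] by (auto simp: g_def intro!: sum_nonneg)
  have "(\<lambda>n. \<integral>\<^sup>+x. ennreal (g n x) \<partial>measure_pmf r) \<longlonglongrightarrow> (\<integral>\<^sup>+x. of_nat x \<partial>measure_pmf r)"
  proof (rule nn_integral_LIMSEQ)
    show "incseq (\<lambda>n x. ennreal (g n x))"
      using a a_mono by (auto simp: incseq_def le_fun_def g_def less_imp_le intro!: ennreal_leI sum_mono power_mono)
    fix x
    have "(\<lambda>n. g n x) \<longlonglongrightarrow> (\<Sum>j<x. 1 ^ j)"
      unfolding g_def by (intro tendsto_intros a_lim)
    then have "(\<lambda>n. ennreal (g n x)) \<longlonglongrightarrow> ennreal (real x)" by (intro tendsto_ennrealI) simp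
    then show "(\<lambda>n. ennreal (g n x)) \<longlonglongrightarrow> of_nat x" by (simp add: ennreal_of_nat_eq_real_of_nat)
  qed simp
  from order_tendstoD(1)[OF this mean] order_tendstoD(1)[OF a_lim \<open>t < 1\<close>]
  have "\<forall>\<^sub>F n in sequentially. 1 < (\<integral>\<^sup>+x. ennreal (g n x) \<partial>measure_pmf r) \<and> t < a n"
    by (rule eventually_conj)
  then obtain n where n: "1 < (\<integral>\<^sup>+x. ennreal (g n x) \<partial>measure_pmf r)" "t < a n"
    by (auto simp: eventually_sequentially)
  have geo: "(1 - a n) * g n x = 1 - a n ^ x" for x
    unfolding g_def by (rule one_diff_power_eq[symmetric])
  have gi: "integrable (measure_pmf r) (g n)"
  proof (rule measure_pmf.integrable_const_bound[where B="1 / (1 - a n)"])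
    have "g n x \<le> 1 / (1 - a n)" for x
    proof -
      have "g n x * (1 - a n) \<le> 1" using geo[of x] a[of n] by (simp add: mult.commute)
      then show ?thesis using a[of n] by (simp add: pos_le_divide_eq)
    qed
    then show "AE x in measure_pmf r. norm (g n x) \<le> 1 / (1 - a n)" using g0 by simp
  qed simp
  have "(\<integral>\<^sup>+x. ennreal (g n x) \<partial>measure_pmf r) = ennreal (\<integral>x. g n x \<partial>measure_pmf r)"
    by (rule nn_integral_eq_integral[OF gi]) (simp add: g0)
  with n have "1 < (\<integral>x. g n x \<partial>measure_pmf r)" by (simp add: ennreal_less_iff flip: ennreal_1)
  then have "1 - a n < (1 - a n) * (\<integral>x. g n x \<partial>measure_pmf r)" using a[of n] by simp
  also have "\<dots> = (\<integral>x. 1 - a n ^ x \<partial>measure_pmf r)" by (simp flip: geo)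
  also have "\<dots> = 1 - pgf r (a n)"
    unfolding pgf_def using a[of n]
    by (subst Bochner_Integration.integral_diff) (auto intro!: integrable_power_pmf)
  finally show thesis using that[of "a n"] n a[of n] by simp
qed

text \<open>With at most one child to the right almost surely, the mean would be at most 1. This is
  what makes good windows possible.\<close>

lemma prob_ge_2_pos:
  fixes p :: "(nat \<times> 'a) pmf"
  assumes "(\<integral>\<^sup>+x. of_nat (fst x) \<partial>measure_pmf p) > 1"
  shows "measure_pmf.prob p {x. 2 \<le> fst x} > 0"
proof (rule ccontr)
  assume "\<not> ?thesis"
  then have "measure_pmf.prob p {x. 2 \<le> fst x} = 0"
    using measure_nonneg[of "measure_pmf p" "{x. 2 \<le> fst x}"] by linarith
  then have "AE x in measure_pmf p. \<not> 2 \<le> fst x"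
    by (auto simp: measure_pmf_zero_iff AE_measure_pmf_iff)
  then have "(\<integral>\<^sup>+x. of_nat (fst x) \<partial>measure_pmf p) \<le> (\<integral>\<^sup>+x. 1 \<partial>measure_pmf p)"
  proof (intro nn_integral_mono_AE, eventually_elim)
    case (elim x)
    then have "fst x \<le> 1" by simp
    then show ?case by (metis of_nat_1 of_nat_mono)
  qed
  then show False using assms by simp
qed

lemma measurable_galton_watson: "(\<lambda>\<omega>. galton_watson \<omega> k) \<in> measurable (iid r) (count_space UNIV)"
proof (induction k)
  case (Suc k)
  show ?case unfolding galton_watson.simps
  proof (rule measurable_compose_countable[where f="\<lambda>z \<omega>. \<Sum>i=1..z. \<omega> (k, i)", OF _ Suc])
    fix z
    have "(\<lambda>\<omega>. sum_list (map (\<lambda>i. \<omega> (k, i)) [1..<Suc z])) \<in> measurable (iid r) (count_space UNIV)"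
      by (rule measurable_compose[OF measurable_map_coords[OF measurable_iid_coord]]) simp
    then show "(\<lambda>\<omega>. \<Sum>i=1..z. \<omega> (k, i)) \<in> measurable (iid r) (count_space UNIV)"
      by (simp only: interv_sum_list_conv_sum_set_nat set_upt atLeastLessThanSuc_atLeastAtMost)
  qed
qed simp

lemma depends_on_galton_watson: "depends_on (\<lambda>\<omega>. galton_watson \<omega> k) ({..<k} \<times> UNIV)"
proof (induction k)
  case (Suc k)
  show ?case unfolding depends_on_def
  proof (intro allI impI)
    fix \<omega> \<omega>' :: "nat \<times> nat \<Rightarrow> nat"
    assume a: "\<forall>i\<in>{..<Suc k} \<times> UNIV. \<omega> i = \<omega>' i"
    have "galton_watson \<omega> k = galton_watson \<omega>' k" by (rule depends_onD[OF Suc]) (use a in auto)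
    then show "galton_watson \<omega> (Suc k) = galton_watson \<omega>' (Suc k)" using a by simp
  qed
qed (simp add: depends_on_def)

text \<open>Integrating out the last generation replaces \<open>s\<close> by \<open>pgf r s\<close>
  in the one before, so the induction leaves \<open>s\<close> free.\<close>

lemma expectation_power_galton_watson:
  assumes "0 \<le> s" "s \<le> 1"
  shows "(\<integral>\<omega>. s ^ galton_watson \<omega> k \<partial>iid r) = (pgf r ^^ k) s"
  using assms
proof (induction k arbitrary: s)
  case 0
  interpret prob_space "iid r :: (nat \<times> nat \<Rightarrow> nat) measure" by (rule prob_space_iid)
  show ?case using prob_space by simp
next
  case (Suc k)
  have p1: "(\<Prod>i\<in>I. s ^ f i) \<le> 1" for I and f :: "nat \<Rightarrow> nat"
    by (intro prod_le_1) (use Suc.prems in \<open>auto simp: power_le_one\<close>)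
  have "(\<integral>\<omega>. s ^ galton_watson \<omega> (Suc k) \<partial>iid r) =
      (\<integral>\<omega>. (\<Prod>i=1..galton_watson \<omega> k. s ^ \<omega> (k, i)) \<partial>iid r)"
    by (simp add: power_sum)
  also have "\<dots> = (\<integral>\<omega>. (\<integral>\<rho>. (\<Prod>i=1..galton_watson \<omega> k. s ^ \<rho> i) \<partial>iid r) \<partial>iid r)"
  proof (rule expectation_indep_row[where h="\<lambda>c \<rho>. \<Prod>i=1..c. s ^ \<rho> i" and C=1,
        OF measurable_galton_watson depends_on_galton_watson])
    show "(\<lambda>\<rho>. \<Prod>i=1..c. s ^ \<rho> i) \<in> borel_measurable (iid r)" for c
      by (intro borel_measurable_prod measurable_compose[OF measurable_iid_coord]) simp
    show "\<bar>\<Prod>i=1..c. s ^ \<rho> i\<bar> \<le> 1" for c and \<rho> :: "nat \<Rightarrow> nat"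
      using p1 Suc.prems by (simp add: prod_nonneg)
  qed
  also have "\<dots> = (\<integral>\<omega>. pgf r s ^ galton_watson \<omega> k \<partial>iid r)"
  proof (rule Bochner_Integration.integral_cong[OF refl])
    fix \<omega> :: "nat \<times> nat \<Rightarrow> nat"
    have "(\<integral>\<rho>. (\<Prod>i=1..galton_watson \<omega> k. s ^ \<rho> i) \<partial>iid r) =
        (\<Prod>i=1..galton_watson \<omega> k. \<integral>x. s ^ x \<partial>measure_pmf r)"
      by (rule expectation_prod_iid[where C=1]) (use Suc.prems in \<open>auto simp: power_le_one\<close>)
    then show "(\<integral>\<rho>. (\<Prod>i=1..galton_watson \<omega> k. s ^ \<rho> i) \<partial>iid r) = pgf r s ^ galton_watson \<omega> k"
      by (simp add: pgf_def)
  qed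
  also have "\<dots> = (pgf r ^^ k) (pgf r s)"
    by (rule Suc.IH) (use Suc.prems in \<open>auto intro: pgf_nonneg pgf_le_1\<close>)
  finally show ?case by (simp add: funpow_swap1)
qed

text \<open>At \<open>s = 0\<close> the power \<open>0 ^ galton_watson \<omega> k\<close> is the
  indicator of extinction by time \<open>k\<close>, and these events increase to extinction.\<close>

lemma extinction_prob_tendsto: "(\<lambda>k. (pgf r ^^ k) 0) \<longlonglongrightarrow> extinction_prob r"
proof -
  interpret prob_space "iid r :: (nat \<times> nat \<Rightarrow> nat) measure" by (rule prob_space_iid)
  let ?A = "\<lambda>k. {\<omega>. galton_watson \<omega> k = 0}"
  have A: "?A k \<in> sets (iid r)" for k
    using measurable_sets[OF measurable_galton_watson, of "{0}" k r] by (simp add: vimage_def)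
  have "galton_watson \<omega> k = 0 \<Longrightarrow> galton_watson \<omega> (Suc k) = 0" for \<omega> k by simp
  then have inc: "incseq ?A" by (intro incseq_SucI) blast
  have "(pgf r ^^ k) 0 = prob (?A k)" for k
  proof -
    have "(pgf r ^^ k) 0 = (\<integral>\<omega>. 0 ^ galton_watson \<omega> k \<partial>iid r)"
      by (rule expectation_power_galton_watson[symmetric]) simp_all
    also have "\<dots> = (\<integral>\<omega>. indicator (?A k) \<omega> \<partial>iid r)"
      by (intro Bochner_Integration.integral_cong refl) (simp add: indicator_def power_0_left)
    also have "\<dots> = prob (?A k)" by simp
    finally show ?thesis .
  qed
  moreover have "(\<lambda>k. prob (?A k)) \<longlonglongrightarrow> prob (\<Union>k. ?A k)"
    by (rule finite_Lim_measure_incseq[OF _ inc]) (use A in blast)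
  moreover have "(\<Union>k. ?A k) = {\<omega>. \<exists>k. galton_watson \<omega> k = 0}" by auto
  ultimately show ?thesis by (simp add: extinction_prob_def iid_array_eq_iid)
qed

lemma pgf_funpow_bounds: "0 \<le> (pgf r ^^ k) 0" "(pgf r ^^ k) 0 \<le> 1"
proof -
  have "0 \<le> (pgf r ^^ k) 0 \<and> (pgf r ^^ k) 0 \<le> 1"
    by (induction k) (auto intro: pgf_nonneg pgf_le_1)
  then show "0 \<le> (pgf r ^^ k) 0" "(pgf r ^^ k) 0 \<le> 1" by auto
qed

lemma extinction_prob_fixed: "pgf r (extinction_prob r) = extinction_prob r"
proof -
  have "(\<lambda>k. pgf r ((pgf r ^^ k) 0)) \<longlonglongrightarrow> pgf r (extinction_prob r)"
    by (rule pgf_tendsto[OF pgf_funpow_bounds extinction_prob_tendsto])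
  moreover have "(\<lambda>k. pgf r ((pgf r ^^ k) 0)) \<longlonglongrightarrow> extinction_prob r"
    using LIMSEQ_Suc[OF extinction_prob_tendsto[of r]] by simp
  ultimately show ?thesis by (rule LIMSEQ_unique)
qed

lemma extinction_prob_nonneg: "0 \<le> extinction_prob r"
  by (simp add: extinction_prob_def)

text \<open>The iterates started at 0 stay below \<open>s\<close> by monotonicity. With
  \<open>extinction_prob_fixed\<close>, the extinction probability is thus the least fixed point in
  the unit interval.\<close>

lemma extinction_prob_le:
  assumes "0 \<le> s" "s \<le> 1" "pgf r s \<le> s"
  shows "extinction_prob r \<le> s"
proof -
  have "(pgf r ^^ k) 0 \<le> s" for k
  proof (induction k)
    case (Suc k)
    have "pgf r ((pgf r ^^ k) 0) \<le> pgf r s"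
      by (rule pgf_mono[OF pgf_funpow_bounds(1) Suc assms(2)])
    then show ?case using assms(3) by simp
  qed (simp add: assms)
  then show ?thesis by (intro LIMSEQ_le_const2[OF extinction_prob_tendsto]) blast
qed

lemma extinction_prob_pos:
  assumes "pmf r 0 > 0"
  shows "0 < extinction_prob r"
proof -
  have "extinction_prob r \<le> 1"
    by (rule extinction_prob_le) (simp_all add: pgf_1)
  then have "pgf r 0 \<le> pgf r (extinction_prob r)"
    by (intro pgf_mono extinction_prob_nonneg) simp_all
  then show ?thesis using assms by (simp add: pgf_0 extinction_prob_fixed)
qed

lemma extinction_prob_less_1:
  assumes "(\<integral>\<^sup>+x. of_nat x \<partial>measure_pmf r) > 1"
  shows "extinction_prob r < 1"
proof -
  obtain s where "0 < s" "s < 1" "pgf r s < s" using ex_pgf_less[OF assms, of 0] by auto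
  then show ?thesis using extinction_prob_le[of s r] by simp
qed

section \<open>The number of leading particles\<close>

definition joint_pgf :: "(nat \<times> nat) pmf \<Rightarrow> real \<Rightarrow> real \<Rightarrow> real" where
  "joint_pgf p x y = (\<integral>z. x ^ fst z * y ^ snd z \<partial>measure_pmf p)"

lemma pgf_map_fst: "pgf (map_pmf fst p) s = (\<integral>z. s ^ fst z \<partial>measure_pmf p)"
  by (simp add: pgf_def)

lemma joint_pgf_1: "joint_pgf p x 1 = pgf (map_pmf fst p) x"
  by (simp add: joint_pgf_def pgf_map_fst)

lemma power_mult_power_le_1:
  fixes x y :: real
  assumes "0 \<le> x" "x \<le> 1" "0 \<le> y" "y \<le> 1"
  shows "0 \<le> x ^ m * y ^ n" "x ^ m * y ^ n \<le> 1"
  using assms by (auto intro!: mult_le_one power_le_one)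

lemma integrable_joint_pgf:
  assumes "0 \<le> x" "x \<le> 1" "0 \<le> y" "y \<le> 1"
  shows "integrable (measure_pmf p) (\<lambda>z. x ^ fst z * y ^ snd z :: real)"
  by (rule measure_pmf.integrable_const_bound[where B=1])
     (use power_mult_power_le_1[OF assms] in auto)

lemma joint_pgf_nonneg: "0 \<le> x \<Longrightarrow> 0 \<le> y \<Longrightarrow> 0 \<le> joint_pgf p x y"
  by (simp add: joint_pgf_def)

lemma joint_pgf_mono:
  assumes "0 \<le> x" "x \<le> x'" "x' \<le> 1" "0 \<le> y" "y \<le> 1"
  shows "joint_pgf p x y \<le> joint_pgf p x' y"
  unfolding joint_pgf_def using assms
  by (intro integral_mono integrable_joint_pgf) (auto intro!: mult_right_mono power_mono)

text \<open>An individual without offspring to the right stays where it is, which costs a factor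
  \<open>1 - y\<close> with the probability of that event.\<close>

lemma joint_pgf_le:
  assumes "AE z in measure_pmf p. fst z + snd z \<ge> 1" "0 \<le> x" "x \<le> 1" "0 \<le> y" "y \<le> 1"
  shows "joint_pgf p x y \<le> pgf (map_pmf fst p) x - (1 - y) * measure_pmf.prob p {z. fst z = 0}"
proof -
  have i: "integrable (measure_pmf p) (\<lambda>z. x ^ fst z)"
    using assms by (intro integrable_power_pmf)
  have j: "integrable (measure_pmf p) (\<lambda>z. (1 - y) * indicator {z. fst z = 0} z)"
    by (intro integrable_mult_right measure_pmf.integrable_const_bound[where B=1]) auto
  have "joint_pgf p x y \<le> (\<integral>z. x ^ fst z - (1 - y) * indicator {z. fst z = 0} z \<partial>measure_pmf p)"
    unfolding joint_pgf_def
  proof (rule integral_mono_AE)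
    show "AE z in measure_pmf p. x ^ fst z * y ^ snd z \<le> x ^ fst z - (1 - y) * indicator {z. fst z = 0} z"
      using assms(1)
    proof eventually_elim
      case (elim z)
      show ?case
      proof (cases "fst z = 0")
        case True
        then have "y ^ snd z \<le> y ^ 1" using elim assms by (intro power_decreasing) auto
        then show ?thesis using True by simp
      next
        case False
        have "x ^ fst z * y ^ snd z \<le> x ^ fst z * 1"
          using assms by (intro mult_left_mono power_le_one) auto
        then show ?thesis using False by simp
      qed
    qed
    show "integrable (measure_pmf p) (\<lambda>z. x ^ fst z - (1 - y) * indicator {z. fst z = 0} z)"
      by (rule Bochner_Integration.integrable_diff[OF i j])
  qed (rule integrable_joint_pgf[OF assms(2-)])
  also have "\<dots> = pgf (map_pmf fst p) x - (1 - y) * measure_pmf.prob p {z. fst z = 0}"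
    by (subst Bochner_Integration.integral_diff[OF i j]) (simp add: pgf_map_fst)
  finally show ?thesis .
qed

section \<open>The joint law of movers and followers\<close>

lemma measurable_of_depends_on_prefix:
  fixes \<Phi> :: "(nat \<Rightarrow> 'b :: countable) \<Rightarrow> 'c"
  assumes "depends_on \<Phi> {..<n}" and "\<And>i. (\<lambda>w. r w i) \<in> measurable M (count_space UNIV)"
  shows "(\<lambda>w. \<Phi> (r w)) \<in> measurable M (count_space UNIV)"
proof -
  have "\<Phi> (r w) = \<Phi> (\<lambda>i. map (r w) [0..<n] ! i)" for w
    by (rule depends_onD[OF assms(1)]) simp
  then show ?thesis
    by (simp only:) (rule measurable_compose[OF measurable_map_coords[OF assms(2)]], simp)
qed

lemma depends_on_movers: "depends_on (\<lambda>\<rho>. movers \<rho> zs) {..<length zs}"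
  unfolding depends_on_def movers_def by (auto simp: sites_def intro!: sum.cong)

lemma depends_on_followers: "depends_on (\<lambda>\<rho>. followers \<rho> zs) {..<length zs}"
  unfolding depends_on_def followers_def
  by (auto simp: sites_def intro!: sum.cong arg_cong2[of _ _ _ _ "(+)"])

text \<open>For a fixed configuration the samples are independent: a leader contributes the factor
  \<open>x ^ fst z * y ^ snd z\<close>, a particle one site behind contributes
  \<open>y ^ fst z\<close>, and all others contribute nothing.\<close>

lemma expectation_movers_followers:
  assumes "0 \<le> x" "x \<le> 1" "0 \<le> y" "y \<le> 1"
  shows "(\<integral>\<rho>. x ^ movers \<rho> zs * y ^ followers \<rho> zs \<partial>iid p) =
    joint_pgf p x y ^ lead zs * pgf (map_pmf fst p) y ^ second zs"
proof -
  let ?I = "sites zs (front zs)" and ?J = "sites zs (front zs - 1)"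
  define F where "F i z = (if i \<in> ?I then x ^ fst z * y ^ snd z else y ^ fst z)" for i and z :: "nat \<times> nat"
  have disj: "?I \<inter> ?J = {}" by (auto simp: sites_def)
  \<comment> \<open>\<open>h\<close> is arbitrary because the split is used twice: for the factors
    on one sample and for their means.\<close>
  have FI: "(\<Prod>i\<in>?I. h (F i) i) = (\<Prod>i\<in>?I. h (\<lambda>z. x ^ fst z * y ^ snd z) i)"
    and FJ: "(\<Prod>i\<in>?J. h (F i) i) = (\<Prod>i\<in>?J. h (\<lambda>z. y ^ fst z) i)" for h :: "(nat \<times> nat \<Rightarrow> real) \<Rightarrow> nat \<Rightarrow> real"
    using disj by (auto intro!: prod.cong arg_cong2[of _ _ _ _ h] simp: F_def fun_eq_iff)
  have "x ^ movers \<rho> zs * y ^ followers \<rho> zs = (\<Prod>i\<in>?I \<union> ?J. F i (\<rho> i))" for \<rho>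
  proof -
    have "(\<Prod>i\<in>?I \<union> ?J. F i (\<rho> i)) = (\<Prod>i\<in>?I. F i (\<rho> i)) * (\<Prod>i\<in>?J. F i (\<rho> i))"
      by (rule prod.union_disjoint) (use disj in auto)
    also have "\<dots> = (\<Prod>i\<in>?I. x ^ fst (\<rho> i) * y ^ snd (\<rho> i)) * (\<Prod>i\<in>?J. y ^ fst (\<rho> i))"
      using FI[of "\<lambda>f i. f (\<rho> i)"] FJ[of "\<lambda>f i. f (\<rho> i)"] by simp
    finally show ?thesis
      by (simp add: movers_def followers_def power_sum power_add prod.distrib mult.assoc)
  qed
  then have "(\<integral>\<rho>. x ^ movers \<rho> zs * y ^ followers \<rho> zs \<partial>iid p) = (\<integral>\<rho>. (\<Prod>i\<in>?I \<union> ?J. F i (\<rho> i)) \<partial>iid p)"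
    by simp
  also have "\<dots> = (\<Prod>i\<in>?I \<union> ?J. \<integral>z. F i z \<partial>measure_pmf p)"
  proof (rule expectation_prod_iid[where C=1])
    show "\<bar>F i z\<bar> \<le> 1" for i z
      using power_mult_power_le_1[OF assms, of "fst z" "snd z"] assms
      by (auto simp: F_def power_le_one)
  qed simp
  also have "\<dots> = (\<Prod>i\<in>?I. \<integral>z. F i z \<partial>measure_pmf p) * (\<Prod>i\<in>?J. \<integral>z. F i z \<partial>measure_pmf p)"
    by (rule prod.union_disjoint) (use disj in auto)
  also have "\<dots> = joint_pgf p x y ^ lead zs * pgf (map_pmf fst p) y ^ second zs"
    using FI[of "\<lambda>f i. \<integral>z. f z \<partial>measure_pmf p"] FJ[of "\<lambda>f i. \<integral>z. f z \<partial>measure_pmf p"]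
    by (simp add: joint_pgf_def pgf_map_fst card_sites lead_def second_def)
  finally show ?thesis .
qed

section \<open>The system started with all particles at the origin\<close>

context
  fixes p :: "(nat \<times> nat) pmf" and N :: nat
  assumes valid: "AE x in measure_pmf p. fst x + snd x \<ge> 1" and N: "0 < N"
begin

definition "conf k \<omega> = run N \<omega> (replicate N 0) k"
definition "movers_at k \<omega> = movers (\<lambda>i. \<omega> (k, i)) (conf k \<omega>)"
definition "followers_at k \<omega> = followers (\<lambda>i. \<omega> (k, i)) (conf k \<omega>)"
definition "lead_at k \<omega> = lead (conf k \<omega>)"
definition "second_at k \<omega> = second (conf k \<omega>)"

lemma measurable_conf: "conf k \<in> measurable (iid p) (count_space UNIV)"
  unfolding conf_def[abs_def] by (rule measurable_run)

lemma measurable_lead_at: "lead_at k \<in> measurable (iid p) (count_space UNIV)"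
  unfolding lead_at_def[abs_def] by (rule measurable_compose[OF measurable_conf]) simp

lemma measurable_second_at: "second_at k \<in> measurable (iid p) (count_space UNIV)"
  unfolding second_at_def[abs_def] by (rule measurable_compose[OF measurable_conf]) simp

lemma measurable_movers_at: "movers_at k \<in> measurable (iid p) (count_space UNIV)"
  unfolding movers_at_def[abs_def]
  by (rule measurable_compose_countable[where f="\<lambda>zs \<omega>. movers (\<lambda>i. \<omega> (k, i)) zs", OF _ measurable_conf])
     (rule measurable_of_depends_on_prefix[OF depends_on_movers measurable_iid_coord])

lemma measurable_followers_at: "followers_at k \<in> measurable (iid p) (count_space UNIV)"
  unfolding followers_at_def[abs_def]
  by (rule measurable_compose_countable[where f="\<lambda>zs \<omega>. followers (\<lambda>i. \<omega> (k, i)) zs", OF _ measurable_conf])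
     (rule measurable_of_depends_on_prefix[OF depends_on_followers measurable_iid_coord])

text \<open>The powers averaged below are bounded functions of these four counts, taken at one time
  or at two, so integrability is settled here once.\<close>

lemma integrable_state:
  fixes F :: "nat \<Rightarrow> nat \<Rightarrow> nat \<Rightarrow> nat \<Rightarrow> real"
  assumes "\<And>a b c d. \<bar>F a b c d\<bar> \<le> C"
  shows "integrable (iid p) (\<lambda>\<omega>. F (movers_at k \<omega>) (followers_at k \<omega>) (lead_at l \<omega>) (second_at l \<omega>))"
proof -
  interpret prob_space "iid p :: (nat \<times> nat \<Rightarrow> nat \<times> nat) measure" by (rule prob_space_iid)
  have "(\<lambda>\<omega>. (\<lambda>(a, b) (c, d). F a b c d) (movers_at k \<omega>, followers_at k \<omega>) (lead_at l \<omega>, second_at l \<omega>)) \<in> measurable (iid p) (count_space UNIV)"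
    by (rule measurable_map2[OF measurable_map2[OF measurable_movers_at measurable_followers_at]
          measurable_map2[OF measurable_lead_at measurable_second_at]])
  then have "(\<lambda>\<omega>. F (movers_at k \<omega>) (followers_at k \<omega>) (lead_at l \<omega>) (second_at l \<omega>)) \<in> measurable (iid p) (count_space UNIV)"
    unfolding prod.case .
  then have "(\<lambda>\<omega>. F (movers_at k \<omega>) (followers_at k \<omega>) (lead_at l \<omega>) (second_at l \<omega>)) \<in> borel_measurable (iid p)"
    by (rule measurable_compose) simp
  then show ?thesis
    by (rule integrable_const_bound[where B=C, rotated]) (use assms in auto)
qed

text \<open>The Markov property turns a mean over the children produced in a step into a mean over
  the counts before that step.\<close>

lemma expectation_movers_followers_at:
  assumes "0 \<le> x" "x \<le> 1" "0 \<le> y" "y \<le> 1"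
  shows "(\<integral>\<omega>. x ^ movers_at k \<omega> * y ^ followers_at k \<omega> \<partial>iid p) =
    (\<integral>\<omega>. joint_pgf p x y ^ lead_at k \<omega> * pgf (map_pmf fst p) y ^ second_at k \<omega> \<partial>iid p)"
proof -
  have d: "depends_on (conf k) ({..<k} \<times> UNIV)"
    unfolding conf_def[abs_def] by (rule depends_on_run)
  have "(\<integral>\<omega>. x ^ movers_at k \<omega> * y ^ followers_at k \<omega> \<partial>iid p) =
      (\<integral>\<omega>. (\<integral>\<rho>. x ^ movers \<rho> (conf k \<omega>) * y ^ followers \<rho> (conf k \<omega>) \<partial>iid p) \<partial>iid p)"
    unfolding movers_at_def followers_at_def
  proof (rule expectation_indep_row[where h="\<lambda>zs \<rho>. x ^ movers \<rho> zs * y ^ followers \<rho> zs" and C=1,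
        OF measurable_conf d])
    fix zs :: "int list"
    have "(\<lambda>\<rho>. x ^ movers \<rho> zs * y ^ followers \<rho> zs) \<in> measurable (iid p) (count_space UNIV)"
      by (rule measurable_map2[where h="\<lambda>m n. x ^ m * y ^ n",
            OF measurable_of_depends_on_prefix[OF depends_on_movers measurable_iid_coord]
               measurable_of_depends_on_prefix[OF depends_on_followers measurable_iid_coord]])
    then show "(\<lambda>\<rho>. x ^ movers \<rho> zs * y ^ followers \<rho> zs) \<in> borel_measurable (iid p)"
      by (rule measurable_compose) simp
    show "\<bar>x ^ movers \<rho> zs * y ^ followers \<rho> zs\<bar> \<le> 1" for \<rho>
      using power_mult_power_le_1[OF assms] by auto
  qed
  also have "\<dots> = (\<integral>\<omega>. joint_pgf p x y ^ lead_at k \<omega> * pgf (map_pmf fst p) y ^ second_at k \<omega> \<partial>iid p)"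
    unfolding expectation_movers_followers[OF assms] lead_at_def second_at_def ..
  finally show ?thesis .
qed

lemma expectation_movers_at:
  assumes "0 \<le> x" "x \<le> 1"
  shows "(\<integral>\<omega>. x ^ movers_at k \<omega> \<partial>iid p) = (\<integral>\<omega>. pgf (map_pmf fst p) x ^ lead_at k \<omega> \<partial>iid p)"
  using expectation_movers_followers_at[OF assms, of 1 k] by (simp add: joint_pgf_1 pgf_1)

lemma lead_at_0: "lead_at 0 \<omega> = N" and second_at_0: "second_at 0 \<omega> = 0"
proof -
  have "front (replicate N 0) = 0" using N by (intro front_eqI) auto
  then show "lead_at 0 \<omega> = N" "second_at 0 \<omega> = 0"
    by (simp_all add: lead_at_def second_at_def conf_def lead_def second_def count_list_replicate)
qed

lemma conf_Suc: "conf (Suc k) \<omega> = step N (\<lambda>i. \<omega> (k, i)) (conf k \<omega>)"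
  by (simp add: conf_def)

lemma conf_facts:
  assumes v: "valid_array \<omega>"
  shows lead_at_pos: "1 \<le> lead_at k \<omega>"
    and lead_at_success: "0 < movers_at k \<omega> \<Longrightarrow> lead_at (Suc k) \<omega> = min N (movers_at k \<omega>)"
    and second_at_success: "0 < movers_at k \<omega> \<Longrightarrow> second_at (Suc k) \<omega> = min (N - movers_at k \<omega>) (followers_at k \<omega>)"
    and lead_at_failure: "movers_at k \<omega> = 0 \<Longrightarrow> lead_at (Suc k) \<omega> = min N (followers_at k \<omega>)"
    and front_Suc: "front (conf (Suc k) \<omega>) = front (conf k \<omega>) + (if movers_at k \<omega> = 0 then 0 else 1)"
proof -
  have l: "length (conf k \<omega>) = N" unfolding conf_def by (rule length_run[OF v N]) simp
  note r = valid_row[OF v N] l N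
  show "1 \<le> lead_at k \<omega>" unfolding lead_at_def by (rule lead_pos[OF r])
  show "lead_at (Suc k) \<omega> = min N (movers_at k \<omega>)" "second_at (Suc k) \<omega> = min (N - movers_at k \<omega>) (followers_at k \<omega>)" if "0 < movers_at k \<omega>"
    using that step_success[OF r] unfolding lead_at_def second_at_def movers_at_def followers_at_def conf_Suc by auto
  show "lead_at (Suc k) \<omega> = min N (followers_at k \<omega>)" if "movers_at k \<omega> = 0"
    using that step_failure[OF r] unfolding lead_at_def movers_at_def followers_at_def conf_Suc by auto
  show "front (conf (Suc k) \<omega>) = front (conf k \<omega>) + (if movers_at k \<omega> = 0 then 0 else 1)"
    unfolding conf_Suc movers_at_def by (rule front_step[OF r])
qed

lemma integrable_power_at:
  assumes "0 \<le> s" "s \<le> (1::real)"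
  shows "integrable (iid p) (\<lambda>\<omega>. s ^ lead_at k \<omega>)" "integrable (iid p) (\<lambda>\<omega>. s ^ movers_at k \<omega>)"
  using integrable_state[where F="\<lambda>a b c d. s ^ c" and C=1] integrable_state[where F="\<lambda>a b c d. s ^ a" and C=1]
    assms by (auto simp: power_le_one)

lemma integrable_power_mult_at:
  assumes "0 \<le> x" "x \<le> (1::real)" "0 \<le> y" "y \<le> 1"
  shows "integrable (iid p) (\<lambda>\<omega>. x ^ lead_at k \<omega> * y ^ second_at k \<omega>)"
    "integrable (iid p) (\<lambda>\<omega>. x ^ movers_at k \<omega> * y ^ followers_at k \<omega>)"
    "integrable (iid p) (\<lambda>\<omega>. x ^ movers_at k \<omega> * y ^ lead_at l \<omega>)"
proof -
  have b: "\<bar>x ^ m * y ^ n\<bar> \<le> 1" for m n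
    using power_mult_power_le_1[OF assms, of m n] by (simp only: abs_of_nonneg)
  show "integrable (iid p) (\<lambda>\<omega>. x ^ lead_at k \<omega> * y ^ second_at k \<omega>)"
    by (rule integrable_state[where F="\<lambda>a b c d. x ^ c * y ^ d" and C=1]) (rule b)
  show "integrable (iid p) (\<lambda>\<omega>. x ^ movers_at k \<omega> * y ^ followers_at k \<omega>)"
    by (rule integrable_state[where F="\<lambda>a b c d. x ^ a * y ^ b" and C=1]) (rule b)
  show "integrable (iid p) (\<lambda>\<omega>. x ^ movers_at k \<omega> * y ^ lead_at l \<omega>)"
    by (rule integrable_state[where F="\<lambda>a b c d. x ^ a * y ^ c" and C=1]) (rule b)
qed

lemma integrable_const_iid: "integrable (iid p :: (nat \<times> nat \<Rightarrow> nat \<times> nat) measure) (\<lambda>\<omega>. c :: real)"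
proof -
  interpret prob_space "iid p :: (nat \<times> nat \<Rightarrow> nat \<times> nat) measure" by (rule prob_space_iid)
  show ?thesis by (rule integrable_const)
qed

lemma integral_const_iid: "(\<integral>\<omega>. (c :: real) \<partial>(iid p :: (nat \<times> nat \<Rightarrow> nat \<times> nat) measure)) = c"
proof -
  interpret prob_space "iid p :: (nat \<times> nat \<Rightarrow> nat \<times> nat) measure" by (rule prob_space_iid)
  show ?thesis using prob_space by simp
qed

text \<open>One factor \<open>x\<close> is traded for \<open>g\<close>, which needs
  \<open>1 \<le> n\<close>. Applied to the number of leaders, this is the source of every
  contraction ratio.\<close>

lemma power_le_ratio_mult:
  fixes g x :: real
  assumes "0 \<le> g" "g \<le> x" "0 < x" "1 \<le> n"
  shows "g ^ n \<le> g / x * x ^ n"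
proof -
  obtain m where m: "n = Suc m" using assms(4) by (cases n) auto
  have "g * g ^ m \<le> g * x ^ m" using assms by (intro mult_left_mono power_mono) auto
  then show ?thesis using assms by (simp add: m)
qed

text \<open>The mean \<open>e\<close> becomes at most \<open>r * e + s ^ N\<close> in one step, with
  \<open>r = pgf (map_pmf fst p) s / s\<close>. The bound is the fixed point of this recursion and
  dominates the initial value \<open>s ^ N\<close>.\<close>

lemma expectation_power_lead_le:
  assumes s: "0 < s" "s < 1" and f: "pgf (map_pmf fst p) s < s"
  shows "(\<integral>\<omega>. s ^ lead_at k \<omega> \<partial>iid p) \<le> s ^ N / (1 - pgf (map_pmf fst p) s / s)"
proof -
  let ?f = "pgf (map_pmf fst p) s"
  define r where "r = ?f / s"
  have f0: "0 \<le> ?f" using s by (intro pgf_nonneg) simp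
  then have r: "0 \<le> r" "r < 1" using s f by (auto simp: r_def)
  have s': "0 \<le> s" "s \<le> 1" using s by auto
  have "(\<integral>\<omega>. s ^ lead_at k \<omega> \<partial>iid p) \<le> s ^ N / (1 - r)"
  proof (induction k)
    case 0
    have "s ^ N * (1 - r) \<le> s ^ N * 1" using s r by (intro mult_left_mono) auto
    then have "s ^ N \<le> s ^ N / (1 - r)" using r by (simp add: pos_le_divide_eq)
    then show ?case unfolding lead_at_0 integral_const_iid .
  next
    case (Suc k)
    have "(\<integral>\<omega>. s ^ lead_at (Suc k) \<omega> \<partial>iid p) \<le> (\<integral>\<omega>. s ^ movers_at k \<omega> + s ^ N \<partial>iid p)"
    proof (rule integral_mono_AE)
      show "AE \<omega> in iid p. s ^ lead_at (Suc k) \<omega> \<le> s ^ movers_at k \<omega> + s ^ N"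
        using AE_valid_array[OF valid]
      proof eventually_elim
        case (elim \<omega>)
        show ?case
        proof (cases "movers_at k \<omega> = 0")
          case True
          \<comment> \<open>A failure asks for no control of the new leaders, because
            \<open>s ^ movers_at k \<omega>\<close> is then already 1.\<close>
          have "s ^ lead_at (Suc k) \<omega> \<le> 1" using s' by (rule power_le_one)
          moreover have "0 \<le> s ^ N" using s by simp
          ultimately show ?thesis using True by simp
        next
          case False
          then have "lead_at (Suc k) \<omega> = min N (movers_at k \<omega>)" using lead_at_success[OF elim] by simp
          then show ?thesis using s by (simp add: min_def)
        qed
      qed
    qed (intro Bochner_Integration.integrable_add integrable_power_at integrable_const_iid s')+
    also have "\<dots> = (\<integral>\<omega>. s ^ movers_at k \<omega> \<partial>iid p) + s ^ N"
      by (subst Bochner_Integration.integral_add[OF integrable_power_at(2)[OF s'] integrable_const_iid])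
        (simp only: integral_const_iid)
    also have "\<dots> = (\<integral>\<omega>. ?f ^ lead_at k \<omega> \<partial>iid p) + s ^ N"
      by (simp only: expectation_movers_at[OF s'])
    also have "(\<integral>\<omega>. ?f ^ lead_at k \<omega> \<partial>iid p) \<le> (\<integral>\<omega>. r * s ^ lead_at k \<omega> \<partial>iid p)"
    proof (rule integral_mono_AE)
      show "AE \<omega> in iid p. ?f ^ lead_at k \<omega> \<le> r * s ^ lead_at k \<omega>"
        using AE_valid_array[OF valid]
      proof eventually_elim
        case (elim \<omega>)
        show ?case unfolding r_def by (rule power_le_ratio_mult[OF f0 _ s(1) lead_at_pos[OF elim]]) (use f in simp)
      qed
      show "integrable (iid p) (\<lambda>\<omega>. ?f ^ lead_at k \<omega>)"
        by (rule integrable_power_at(1)[OF f0]) (use f s in simp)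
    qed (intro integrable_mult_right integrable_power_at s')
    also have "(\<integral>\<omega>. r * s ^ lead_at k \<omega> \<partial>iid p) = r * (\<integral>\<omega>. s ^ lead_at k \<omega> \<partial>iid p)" by simp
    also have "\<dots> \<le> r * (s ^ N / (1 - r))" using Suc r by (intro mult_left_mono)
    also have "r * (s ^ N / (1 - r)) + s ^ N = s ^ N / (1 - r)" using r by (simp add: field_simps)
    finally show ?case by simp
  qed
  then show ?thesis by (simp add: r_def)
qed

text \<open>A recursion with ratio \<open>joint_pgf p x q / x\<close> and error
  \<open>x ^ N + q ^ N * D\<close>. The site behind keeps its weight exactly, so the whole gain
  comes from the leaders. \<open>D\<close> controls the error of the selection, as
  \<open>pgf (map_pmf fst p) (x / q) ^ lead_at k\<close> has the same mean as
  \<open>(x / q) ^ movers_at k\<close>.\<close>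

lemma expectation_power_lead_second_le:
  assumes q: "0 < q" "q < 1" and fq: "pgf (map_pmf fst p) q = q" and x: "0 < x" "x < q"
    and g: "joint_pgf p x q < x" and D: "\<And>k. (\<integral>\<omega>. pgf (map_pmf fst p) (x / q) ^ lead_at k \<omega> \<partial>iid p) \<le> D"
  shows "(\<integral>\<omega>. x ^ lead_at k \<omega> * q ^ second_at k \<omega> \<partial>iid p) \<le> (x ^ N + q ^ N * D) / (1 - joint_pgf p x q / x)"
proof -
  let ?g = "joint_pgf p x q"
  define r where "r = ?g / x"
  define c where "c = x ^ N + q ^ N * D"
  have g0: "0 \<le> ?g" using x q by (intro joint_pgf_nonneg) auto
  then have r: "0 \<le> r" "r < 1" using x g by (auto simp: r_def)
  have x': "0 \<le> x" "x \<le> 1" and q': "0 \<le> q" "q \<le> 1" and xq: "0 \<le> x / q" "x / q \<le> 1"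
    using x q by auto
  have "0 \<le> (\<integral>\<omega>. pgf (map_pmf fst p) (x / q) ^ lead_at 0 \<omega> \<partial>iid p)"
    using pgf_nonneg[OF xq(1)] by (intro integral_nonneg_AE AE_I2) simp
  with D[of 0] have D0: "0 \<le> D" by linarith
  have "(\<integral>\<omega>. x ^ lead_at k \<omega> * q ^ second_at k \<omega> \<partial>iid p) \<le> c / (1 - r)"
  proof (induction k)
    case 0
    have c0: "0 \<le> c" "x ^ N \<le> c" using D0 x q by (auto simp: c_def)
    have "c * (1 - r) \<le> c * 1" using c0 r by (intro mult_left_mono) auto
    then have "c \<le> c / (1 - r)" using r by (simp add: pos_le_divide_eq)
    then show ?case unfolding lead_at_0 second_at_0 integral_const_iid using c0 by simp
  next
    case (Suc k)
    have i1: "integrable (iid p) (\<lambda>\<omega>. x ^ movers_at k \<omega> * q ^ followers_at k \<omega>)"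
      by (rule integrable_power_mult_at(2)[OF x' q'])
    have i2: "integrable (iid p) (\<lambda>\<omega>. q ^ N * (x / q) ^ movers_at k \<omega>)"
      by (intro integrable_mult_right integrable_power_at xq)
    have "(\<integral>\<omega>. x ^ lead_at (Suc k) \<omega> * q ^ second_at (Suc k) \<omega> \<partial>iid p) \<le>
        (\<integral>\<omega>. x ^ N + (x ^ movers_at k \<omega> * q ^ followers_at k \<omega> + q ^ N * (x / q) ^ movers_at k \<omega>) \<partial>iid p)"
    proof (rule integral_mono_AE)
      show "AE \<omega> in iid p. x ^ lead_at (Suc k) \<omega> * q ^ second_at (Suc k) \<omega> \<le>
          x ^ N + (x ^ movers_at k \<omega> * q ^ followers_at k \<omega> + q ^ N * (x / q) ^ movers_at k \<omega>)"
        using AE_valid_array[OF valid]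
      proof eventually_elim
        case (elim \<omega>)
        define S W A B where "S = movers_at k \<omega>" and "W = followers_at k \<omega>"
          and "A = lead_at (Suc k) \<omega>" and "B = second_at (Suc k) \<omega>"
        have pos: "0 \<le> x ^ N" "0 \<le> x ^ S * q ^ W" "0 \<le> q ^ N * (x / q) ^ S" using x q by auto
        have qm: "q ^ min m n \<le> q ^ m + q ^ n" for m n using q by (simp add: min_def)
        consider "S = 0" | "0 < S" "N \<le> S" | "0 < S" "S < N" by linarith
        then have "x ^ A * q ^ B \<le> x ^ N + (x ^ S * q ^ W + q ^ N * (x / q) ^ S)"
        proof cases
          case 1
          \<comment> \<open>After a failure the weight of the leaders is raised from
            \<open>x\<close> to \<open>q\<close>, which gives at most \<open>q ^ N + q ^ W\<close>.
            Both terms are present on the right because \<open>S = 0\<close>.\<close>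
          then have A: "A = min N W" using lead_at_failure[OF elim] by (simp add: A_def S_def W_def)
          have "x ^ A * q ^ B \<le> x ^ A * 1" using x q by (intro mult_left_mono power_le_one) auto
          also have "\<dots> \<le> q ^ A" using x by (auto intro: power_mono)
          also have "\<dots> \<le> q ^ N + q ^ W" unfolding A by (rule qm)
          finally show ?thesis using pos(1) 1 by simp
        next
          case 2
          then have A: "A = N" using lead_at_success[OF elim, of k] by (simp add: A_def S_def)
          have "x ^ A * q ^ B \<le> x ^ A * 1" using x q by (intro mult_left_mono power_le_one) auto
          then show ?thesis using pos A by simp
        next
          case 3
          then have A: "A = S" and B: "B = min (N - S) W"
            using lead_at_success[OF elim, of k] second_at_success[OF elim, of k]
            by (simp_all add: A_def B_def S_def W_def)
          \<comment> \<open>If the selection cuts the second site, the weight is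
            \<open>x ^ S * q ^ (N - S) = q ^ N * (x / q) ^ S\<close>: this is the origin of the last
            term.\<close>
          have "x ^ A * q ^ B \<le> x ^ S * (q ^ (N - S) + q ^ W)"
            unfolding A B using x by (intro mult_left_mono qm) simp
          also have "\<dots> = x ^ S * q ^ W + q ^ N * (x / q) ^ S"
            using 3 q by (simp add: algebra_simps power_divide power_diff)
          finally show ?thesis using pos by simp
        qed
        then show ?case by (simp only: S_def W_def A_def B_def)
      qed
      show "integrable (iid p) (\<lambda>\<omega>. x ^ lead_at (Suc k) \<omega> * q ^ second_at (Suc k) \<omega>)"
        by (rule integrable_power_mult_at(1)[OF x' q'])
      show "integrable (iid p) (\<lambda>\<omega>. x ^ N + (x ^ movers_at k \<omega> * q ^ followers_at k \<omega> + q ^ N * (x / q) ^ movers_at k \<omega>))"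
        by (rule Bochner_Integration.integrable_add[OF integrable_const_iid Bochner_Integration.integrable_add[OF i1 i2]])
    qed
    also have "\<dots> = x ^ N + ((\<integral>\<omega>. x ^ movers_at k \<omega> * q ^ followers_at k \<omega> \<partial>iid p) + q ^ N * (\<integral>\<omega>. (x / q) ^ movers_at k \<omega> \<partial>iid p))"
      by (subst Bochner_Integration.integral_add[OF integrable_const_iid Bochner_Integration.integrable_add[OF i1 i2]],
          subst Bochner_Integration.integral_add[OF i1 i2], subst integral_const_iid, subst integral_mult_right_zero, rule refl)
    also have "(\<integral>\<omega>. x ^ movers_at k \<omega> * q ^ followers_at k \<omega> \<partial>iid p) = (\<integral>\<omega>. ?g ^ lead_at k \<omega> * q ^ second_at k \<omega> \<partial>iid p)"
      by (simp only: expectation_movers_followers_at[OF x' q'] fq)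
    also have "\<dots> \<le> (\<integral>\<omega>. r * (x ^ lead_at k \<omega> * q ^ second_at k \<omega>) \<partial>iid p)"
    proof (rule integral_mono_AE)
      show "AE \<omega> in iid p. ?g ^ lead_at k \<omega> * q ^ second_at k \<omega> \<le> r * (x ^ lead_at k \<omega> * q ^ second_at k \<omega>)"
        using AE_valid_array[OF valid]
      proof eventually_elim
        case (elim \<omega>)
        have "?g ^ lead_at k \<omega> \<le> r * x ^ lead_at k \<omega>"
          unfolding r_def by (rule power_le_ratio_mult[OF g0 _ x(1) lead_at_pos[OF elim]]) (use g in simp)
        then show ?case using q by (simp add: mult_right_mono mult.assoc[symmetric])
      qed
      show "integrable (iid p) (\<lambda>\<omega>. ?g ^ lead_at k \<omega> * q ^ second_at k \<omega>)"
        by (rule integrable_power_mult_at(1)[OF g0 _ q']) (use g x' in simp)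
      show "integrable (iid p) (\<lambda>\<omega>. r * (x ^ lead_at k \<omega> * q ^ second_at k \<omega>))"
        by (intro integrable_mult_right integrable_power_mult_at x' q')
    qed
    also have "\<dots> = r * (\<integral>\<omega>. x ^ lead_at k \<omega> * q ^ second_at k \<omega> \<partial>iid p)" by (rule integral_mult_right_zero)
    also have "\<dots> \<le> r * (c / (1 - r))" using Suc r by (intro mult_left_mono)
    also have "(\<integral>\<omega>. (x / q) ^ movers_at k \<omega> \<partial>iid p) \<le> D"
      using D[of k] by (simp only: expectation_movers_at[OF xq])
    finally have "(\<integral>\<omega>. x ^ lead_at (Suc k) \<omega> * q ^ second_at (Suc k) \<omega> \<partial>iid p) \<le> x ^ N + (r * (c / (1 - r)) + q ^ N * D)"
      using q by (simp add: mult_left_mono)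
    also have "\<dots> = c / (1 - r)" using r by (simp add: c_def field_simps)
    finally show ?case .
  qed
  then show ?thesis by (simp add: r_def c_def)
qed

lemma integrable_excess:
  assumes "0 \<le> q" "q \<le> (1::real)"
  shows "integrable (iid p) (\<lambda>\<omega>. max 0 (q ^ N - q ^ movers_at k \<omega>))"
proof (rule integrable_state[where F="\<lambda>a b c d. max 0 (q ^ N - q ^ a)" and C=1])
  fix a :: nat
  have "q ^ N \<le> 1" "0 \<le> q ^ a" using assms by (auto intro: power_le_one)
  then show "\<bar>max 0 (q ^ N - q ^ a)\<bar> \<le> 1" by simp
qed

text \<open>By \<open>pgf q = q\<close> the power \<open>q ^ movers_at\<close> has the same mean as \<open>q ^ lead_at\<close>: the truncation at
  \<open>N\<close> is balanced by the failures, where \<open>0 ^ movers_at\<close> is the indicator of a failure.\<close>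

lemma failure_balance:
  assumes q: "0 < q" "q < 1" and fq: "pgf (map_pmf fst p) q = q"
  shows "(\<integral>\<omega>. 0 ^ movers_at k \<omega> \<partial>iid p) =
    (\<integral>\<omega>. q ^ lead_at k \<omega> \<partial>iid p) - (\<integral>\<omega>. q ^ lead_at (Suc k) \<omega> \<partial>iid p)
    + (\<integral>\<omega>. max 0 (q ^ N - q ^ movers_at k \<omega>) \<partial>iid p)
    + (\<integral>\<omega>. 0 ^ movers_at k \<omega> * q ^ lead_at (Suc k) \<omega> \<partial>iid p)"
proof -
  have q': "0 \<le> q" "q \<le> 1" and z: "(0::real) \<le> 0" "(0::real) \<le> 1" using q by auto
  note i0 = integrable_power_at(2)[OF z, of k] and i1 = integrable_power_at(2)[OF q', of k]
    and i2 = integrable_power_at(1)[OF q', of "Suc k"] and i3 = integrable_excess[OF q', of k]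
    and i4 = integrable_power_mult_at(3)[OF z q', of k "Suc k"]
  \<comment> \<open>The identity holds on each valid sample: after a success,
    \<open>q ^ min N S\<close> is \<open>q ^ S\<close> plus the excess caused by truncation, where
    \<open>S\<close> is the number of movers; after a failure both sides equal 1 plus the power of
    the new leaders.\<close>
  have "(\<integral>\<omega>. q ^ lead_at (Suc k) \<omega> + 0 ^ movers_at k \<omega> \<partial>iid p) =
    (\<integral>\<omega>. q ^ movers_at k \<omega> + max 0 (q ^ N - q ^ movers_at k \<omega>) +
      0 ^ movers_at k \<omega> * q ^ lead_at (Suc k) \<omega> \<partial>iid p)"
  proof (rule integral_cong_AE)
    show "AE \<omega> in iid p. q ^ lead_at (Suc k) \<omega> + 0 ^ movers_at k \<omega> =
      q ^ movers_at k \<omega> + max 0 (q ^ N - q ^ movers_at k \<omega>) + 0 ^ movers_at k \<omega> * q ^ lead_at (Suc k) \<omega>"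
      using AE_valid_array[OF valid]
    proof eventually_elim
      case (elim \<omega>)
      show ?case
      proof (cases "movers_at k \<omega> = 0")
        case True
        have "q ^ N \<le> 1" using q' by (rule power_le_one)
        then show ?thesis using True by simp
      next
        case False
        then have l: "lead_at (Suc k) \<omega> = min N (movers_at k \<omega>)" using lead_at_success[OF elim] by simp
        have z: "(0::real) ^ movers_at k \<omega> = 0" using False by simp
        show ?thesis
        proof (cases "N \<le> movers_at k \<omega>")
          case True
          then have "q ^ movers_at k \<omega> \<le> q ^ N" using q by (intro power_decreasing) auto
          then show ?thesis unfolding l z using True by simp
        next
          case False
          then have "q ^ N \<le> q ^ movers_at k \<omega>" using q by (intro power_decreasing) auto
          then show ?thesis unfolding l z using False by simp
        qed
      qed
    qed
  qed (intro borel_measurable_integrable Bochner_Integration.integrable_add i0 i1 i2 i3 i4)+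
  then have "(\<integral>\<omega>. q ^ lead_at (Suc k) \<omega> \<partial>iid p) + (\<integral>\<omega>. 0 ^ movers_at k \<omega> \<partial>iid p) =
    (\<integral>\<omega>. q ^ movers_at k \<omega> \<partial>iid p) + (\<integral>\<omega>. max 0 (q ^ N - q ^ movers_at k \<omega>) \<partial>iid p) +
      (\<integral>\<omega>. 0 ^ movers_at k \<omega> * q ^ lead_at (Suc k) \<omega> \<partial>iid p)"
    unfolding Bochner_Integration.integral_add[OF i2 i0] Bochner_Integration.integral_add[OF i1 i3]
      Bochner_Integration.integral_add[OF Bochner_Integration.integrable_add[OF i1 i3] i4] .
  moreover have "(\<integral>\<omega>. q ^ movers_at k \<omega> \<partial>iid p) = (\<integral>\<omega>. q ^ lead_at k \<omega> \<partial>iid p)"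
    by (simp only: expectation_movers_at[OF q'] fq)
  ultimately show ?thesis by linarith
qed

text \<open>Each step advances the front by \<open>1 - 0 ^ movers_at k \<omega>\<close>, so the
  shortfall from \<open>n\<close> counts failures.\<close>

lemma expectation_front:
  "(\<integral>\<omega>. real_of_int (front (conf n \<omega>)) \<partial>iid p) = real n - (\<Sum>k<n. \<integral>\<omega>. 0 ^ movers_at k \<omega> \<partial>iid p)"
proof -
  interpret prob_space "iid p :: (nat \<times> nat \<Rightarrow> nat \<times> nat) measure" by (rule prob_space_iid)
  have i: "integrable (iid p) (\<lambda>\<omega>. real_of_int (front (conf n \<omega>)))" for n
  proof (rule integrable_const_bound[where B="real n"])
    show "AE \<omega> in iid p. norm (real_of_int (front (conf n \<omega>))) \<le> real n"
      using AE_valid_array[OF valid]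
    proof eventually_elim
      case (elim \<omega>)
      show ?case using front_run_origin[OF elim N, of n] by (simp add: conf_def)
    qed
    show "(\<lambda>\<omega>. real_of_int (front (conf n \<omega>))) \<in> borel_measurable (iid p)"
      by (rule measurable_compose[OF measurable_conf]) simp
  qed
  have z: "(0::real) \<le> 0" "(0::real) \<le> 1" by auto
  note j = integrable_power_at(2)[OF z]
  show ?thesis
  proof (induction n)
    case 0
    have "front (replicate N 0) = 0" using N by (intro front_eqI) auto
    then show ?case by (simp add: conf_def)
  next
    case (Suc n)
    have "(\<integral>\<omega>. real_of_int (front (conf (Suc n) \<omega>)) \<partial>iid p) =
        (\<integral>\<omega>. real_of_int (front (conf n \<omega>)) + (1 - 0 ^ movers_at n \<omega>) \<partial>iid p)"
    proof (rule integral_cong_AE)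
      show "AE \<omega> in iid p. real_of_int (front (conf (Suc n) \<omega>)) =
          real_of_int (front (conf n \<omega>)) + (1 - 0 ^ movers_at n \<omega>)"
        using AE_valid_array[OF valid]
      proof eventually_elim
        case (elim \<omega>)
        show ?case unfolding front_Suc[OF elim] by (simp add: power_0_left)
      qed
    qed (intro borel_measurable_integrable Bochner_Integration.integrable_add
          Bochner_Integration.integrable_diff integrable_const_iid i j)+
    also have "\<dots> = (\<integral>\<omega>. real_of_int (front (conf n \<omega>)) \<partial>iid p) + (1 - (\<integral>\<omega>. 0 ^ movers_at n \<omega> \<partial>iid p))"
      by (subst Bochner_Integration.integral_add[OF i Bochner_Integration.integrable_diff[OF integrable_const_iid j]],
          subst Bochner_Integration.integral_diff[OF integrable_const_iid j], subst integral_const_iid, rule refl)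
    finally show ?case using Suc by simp
  qed
qed

lemma failure_rate_tendsto:
  assumes "measure_pmf.prob p {x. 2 \<le> fst x} > 0"
  shows "(\<lambda>n. (\<Sum>k<n. \<integral>\<omega>. 0 ^ movers_at k \<omega> \<partial>iid p) / real n) \<longlonglongrightarrow> 1 - speed p N"
proof -
  have "(\<lambda>n. 1 - (\<integral>\<omega>. real_of_int (front (conf n \<omega>)) \<partial>iid p) / real n) \<longlonglongrightarrow> 1 - speed p N"
    unfolding conf_def by (intro tendsto_diff tendsto_const speed_eq_limit_expectation valid assms N)
  moreover have "\<forall>\<^sub>F n in sequentially. 1 - (\<integral>\<omega>. real_of_int (front (conf n \<omega>)) \<partial>iid p) / real n =
      (\<Sum>k<n. \<integral>\<omega>. 0 ^ movers_at k \<omega> \<partial>iid p) / real n"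
    using eventually_gt_at_top[of 0]
    by eventually_elim (simp add: expectation_front diff_divide_distrib)
  ultimately show ?thesis by (rule Lim_transform_eventually)
qed

text \<open>Summed over time, the differences of \<open>q ^ lead_at\<close> in
  \<open>failure_balance\<close> telescope to a quantity of absolute value at most 1, which vanishes
  in the average. Uniform bounds on the two other terms then pass to the speed.\<close>

lemma failure_rate_bounds:
  assumes branching: "measure_pmf.prob p {x. 2 \<le> fst x} > 0"
    and q: "0 < q" "q < 1" and fq: "pgf (map_pmf fst p) q = q"
    and b: "\<And>k. (\<integral>\<omega>. max 0 (q ^ N - q ^ movers_at k \<omega>) \<partial>iid p)
        + (\<integral>\<omega>. 0 ^ movers_at k \<omega> * q ^ lead_at (Suc k) \<omega> \<partial>iid p) \<in> {a..c}"
  shows "a \<le> 1 - speed p N" "1 - speed p N \<le> c"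
proof -
  let ?e = "\<lambda>k. \<integral>\<omega>. q ^ lead_at k \<omega> \<partial>iid p"
  let ?h = "\<lambda>k. (\<integral>\<omega>. max 0 (q ^ N - q ^ movers_at k \<omega>) \<partial>iid p)
        + (\<integral>\<omega>. 0 ^ movers_at k \<omega> * q ^ lead_at (Suc k) \<omega> \<partial>iid p)"
  let ?s = "\<lambda>n. \<Sum>k<n. \<integral>\<omega>. 0 ^ movers_at k \<omega> \<partial>iid p"
  have q': "0 \<le> q" "q \<le> 1" using q by auto
  have e: "0 \<le> ?e k" "?e k \<le> 1" for k
  proof -
    show "0 \<le> ?e k" using q by (intro integral_nonneg_AE AE_I2) simp
    have "?e k \<le> (\<integral>\<omega>. 1 \<partial>(iid p :: (nat \<times> nat \<Rightarrow> nat \<times> nat) measure))"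
      by (intro integral_mono integrable_power_at integrable_const_iid q' power_le_one)
    then show "?e k \<le> 1" unfolding integral_const_iid .
  qed
  have tele: "?s n = ?e 0 - ?e n + (\<Sum>k<n. ?h k)" for n
  proof (induction n)
    case (Suc n)
    then show ?case using failure_balance[OF q fq, of n] by simp
  qed simp
  have "real n * a \<le> (\<Sum>k<n. ?h k)" "(\<Sum>k<n. ?h k) \<le> real n * c" for n
    using sum_bounded_below[of "{..<n}" a ?h] sum_bounded_above[of "{..<n}" ?h c] b by auto
  then have s: "real n * a - 1 \<le> ?s n" "?s n \<le> real n * c + 1" for n
    using tele[of n] e[of 0] e[of n] by (smt (verit))+
  note lim = failure_rate_tendsto[OF branching]
  have l0: "(\<lambda>n. a - 1 / real n) \<longlonglongrightarrow> a - 0" "(\<lambda>n. c + 1 / real n) \<longlonglongrightarrow> c + 0"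
    by (intro tendsto_intros lim_1_over_n)+
  have "a - 0 \<le> 1 - speed p N"
  proof (rule LIMSEQ_le[OF l0(1) lim], intro exI allI impI)
    fix n :: nat assume "1 \<le> n"
    then show "a - 1 / real n \<le> ?s n / real n"
      using divide_right_mono[OF s(1)[of n], of "real n"] by (simp add: diff_divide_distrib)
  qed
  then show "a \<le> 1 - speed p N" by simp
  have "1 - speed p N \<le> c + 0"
  proof (rule LIMSEQ_le[OF lim l0(2)], intro exI allI impI)
    fix n :: nat assume "1 \<le> n"
    then show "?s n / real n \<le> c + 1 / real n"
      using divide_right_mono[OF s(2)[of n], of "real n"] by (simp add: add_divide_distrib)
  qed
  then show "1 - speed p N \<le> c" by simp
qed

text \<open>Let \<open>S\<close> be the number of movers. For \<open>S \<ge> N\<close>,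
  \<open>q \<le> s\<close> gives \<open>q ^ N - q ^ S \<ge> q ^ N * (1 - s ^ S / s ^ N)\<close>; for
  \<open>S < N\<close> the right side is negative. The loss \<open>M / s ^ N\<close> is small once
  \<open>M\<close> is of order \<open>t ^ N\<close> with \<open>t < s\<close>.\<close>

lemma excess_ge:
  fixes q s :: real
  assumes q: "0 < q" "q \<le> s" "s < 1" and M: "(\<integral>\<omega>. s ^ movers_at k \<omega> \<partial>iid p) \<le> M"
  shows "q ^ N * (1 - M / s ^ N) \<le> (\<integral>\<omega>. max 0 (q ^ N - q ^ movers_at k \<omega>) \<partial>iid p)"
proof -
  have s: "0 < s" "0 \<le> s" "s \<le> 1" and q': "0 \<le> q" "q \<le> 1" using q by auto
  note i = integrable_power_at(2)[OF s(2,3), of k]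
  have j: "integrable (iid p) (\<lambda>\<omega>. q ^ N / s ^ N * s ^ movers_at k \<omega>)"
    by (rule integrable_mult_right[OF i])
  have "q ^ N * (1 - M / s ^ N) = q ^ N - q ^ N / s ^ N * M" using s by (simp add: field_simps)
  also have "\<dots> \<le> q ^ N - q ^ N / s ^ N * (\<integral>\<omega>. s ^ movers_at k \<omega> \<partial>iid p)"
    using M s q by (intro diff_left_mono mult_left_mono) auto
  also have "\<dots> = (\<integral>\<omega>. q ^ N - q ^ N / s ^ N * s ^ movers_at k \<omega> \<partial>iid p)"
    by (subst Bochner_Integration.integral_diff[OF integrable_const_iid j], subst integral_const_iid,
        subst integral_mult_right_zero, rule refl)
  also have "\<dots> \<le> (\<integral>\<omega>. max 0 (q ^ N - q ^ movers_at k \<omega>) \<partial>iid p)"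
  proof (rule integral_mono)
    fix \<omega>
    define S where "S = movers_at k \<omega>"
    have "q ^ N - q ^ N / s ^ N * s ^ S \<le> max 0 (q ^ N - q ^ S)"
    proof (cases "N \<le> S")
      case True
      have "q ^ S = q ^ N * q ^ (S - N)" using True by (simp flip: power_add)
      also have "\<dots> \<le> q ^ N * s ^ (S - N)" using q by (intro mult_left_mono power_mono) auto
      also have "\<dots> = q ^ N / s ^ N * s ^ S" using True s by (simp add: power_diff)
      finally show ?thesis by simp
    next
      case False
      then have "s ^ N \<le> s ^ S" using s by (intro power_decreasing) auto
      then have "q ^ N / s ^ N * s ^ N \<le> q ^ N / s ^ N * s ^ S" using s q by (intro mult_left_mono) auto
      then have "q ^ N \<le> q ^ N / s ^ N * s ^ S" using s by simp
      then show ?thesis by simp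
    qed
    then show "q ^ N - q ^ N / s ^ N * s ^ movers_at k \<omega> \<le> max 0 (q ^ N - q ^ movers_at k \<omega>)"
      by (simp only: S_def)
  qed (intro Bochner_Integration.integrable_diff integrable_const_iid j integrable_excess q')+
  finally show ?thesis .
qed

lemma excess_le:
  fixes q :: real
  assumes "0 < q" "q < 1"
  shows "(\<integral>\<omega>. max 0 (q ^ N - q ^ movers_at k \<omega>) \<partial>iid p) \<le> q ^ N"
proof -
  have q': "0 \<le> q" "q \<le> 1" using assms by auto
  have "(\<integral>\<omega>. max 0 (q ^ N - q ^ movers_at k \<omega>) \<partial>iid p) \<le>
      (\<integral>\<omega>. q ^ N \<partial>(iid p :: (nat \<times> nat \<Rightarrow> nat \<times> nat) measure))"
    by (rule integral_mono[OF integrable_excess[OF q'] integrable_const_iid]) (use q' in simp)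
  then show ?thesis unfolding integral_const_iid .
qed

text \<open>Integrating out the step gives the weight \<open>joint_pgf p 0 q\<close> to each leader,
  and \<open>joint_pgf p 0 q \<le> joint_pgf p x q < x\<close> compares it with \<open>U\<close>.
  The term \<open>q ^ N * D\<close> covers the case that the selection cuts the followers at
  \<open>N\<close>.\<close>

lemma failure_small_lead_le:
  assumes q: "0 < q" "q < 1" and fq: "pgf (map_pmf fst p) q = q" and x: "0 < x" "x < q"
    and g: "joint_pgf p x q < x"
    and U: "(\<integral>\<omega>. x ^ lead_at k \<omega> * q ^ second_at k \<omega> \<partial>iid p) \<le> U"
    and D: "(\<integral>\<omega>. pgf (map_pmf fst p) 0 ^ lead_at k \<omega> \<partial>iid p) \<le> D"
  shows "(\<integral>\<omega>. 0 ^ movers_at k \<omega> * q ^ lead_at (Suc k) \<omega> \<partial>iid p) \<le> U + q ^ N * D"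
proof -
  have q': "0 \<le> q" "q \<le> 1" and z: "(0::real) \<le> 0" "(0::real) \<le> 1" and x': "0 \<le> x" "x \<le> 1"
    using q x by auto
  have i1: "integrable (iid p) (\<lambda>\<omega>. 0 ^ movers_at k \<omega> * q ^ followers_at k \<omega>)"
    by (rule integrable_power_mult_at(2)[OF z q'])
  have i2: "integrable (iid p) (\<lambda>\<omega>. q ^ N * 0 ^ movers_at k \<omega>)"
    by (intro integrable_mult_right integrable_power_at z)
  have g0: "0 \<le> joint_pgf p 0 q" using q by (intro joint_pgf_nonneg) auto
  have gx: "joint_pgf p 0 q \<le> x" using joint_pgf_mono[OF z(1) x' q', of p] g by simp
  have "(\<integral>\<omega>. 0 ^ movers_at k \<omega> * q ^ lead_at (Suc k) \<omega> \<partial>iid p) \<le>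
      (\<integral>\<omega>. 0 ^ movers_at k \<omega> * q ^ followers_at k \<omega> + q ^ N * 0 ^ movers_at k \<omega> \<partial>iid p)"
  proof (rule integral_mono_AE)
    show "AE \<omega> in iid p. 0 ^ movers_at k \<omega> * q ^ lead_at (Suc k) \<omega> \<le>
        0 ^ movers_at k \<omega> * q ^ followers_at k \<omega> + q ^ N * 0 ^ movers_at k \<omega>"
      using AE_valid_array[OF valid]
    proof eventually_elim
      case (elim \<omega>)
      show ?case
      proof (cases "movers_at k \<omega> = 0")
        case True
        then have "lead_at (Suc k) \<omega> = min N (followers_at k \<omega>)" by (rule lead_at_failure[OF elim])
        then show ?thesis using True q by (simp add: min_def)
      next
        case False
        then have z: "(0::real) ^ movers_at k \<omega> = 0" by simp
        show ?thesis unfolding z by simp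
      qed
    qed
  qed (intro integrable_power_mult_at(3) z q' Bochner_Integration.integrable_add[OF i1 i2])+
  also have "\<dots> = (\<integral>\<omega>. 0 ^ movers_at k \<omega> * q ^ followers_at k \<omega> \<partial>iid p) + q ^ N * (\<integral>\<omega>. 0 ^ movers_at k \<omega> \<partial>iid p)"
    by (subst Bochner_Integration.integral_add[OF i1 i2], subst integral_mult_right_zero, rule refl)
  also have "(\<integral>\<omega>. 0 ^ movers_at k \<omega> * q ^ followers_at k \<omega> \<partial>iid p) =
      (\<integral>\<omega>. joint_pgf p 0 q ^ lead_at k \<omega> * q ^ second_at k \<omega> \<partial>iid p)"
    by (simp only: expectation_movers_followers_at[OF z q'] fq)
  also have "\<dots> \<le> (\<integral>\<omega>. x ^ lead_at k \<omega> * q ^ second_at k \<omega> \<partial>iid p)"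
  proof (rule integral_mono)
    show "joint_pgf p 0 q ^ lead_at k \<omega> * q ^ second_at k \<omega> \<le> x ^ lead_at k \<omega> * q ^ second_at k \<omega>" for \<omega>
      using q by (intro mult_right_mono power_mono gx g0) simp
    show "integrable (iid p) (\<lambda>\<omega>. joint_pgf p 0 q ^ lead_at k \<omega> * q ^ second_at k \<omega>)"
      by (rule integrable_power_mult_at(1)[OF g0 _ q']) (use gx x' in simp)
  qed (rule integrable_power_mult_at(1)[OF x' q'])
  also have "\<dots> \<le> U" by (rule U)
  also have "(\<integral>\<omega>. 0 ^ movers_at k \<omega> \<partial>iid p) \<le> D"
    using D by (simp only: expectation_movers_at[OF z])
  finally show ?thesis using q by (simp add: mult_left_mono)
qed

text \<open>\<open>t\<close> lies between the generating function at \<open>s\<close> and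
  \<open>s\<close> itself, so that the mean of \<open>s ^ movers_at\<close> is of order
  \<open>t ^ N\<close>, small against \<open>s ^ N\<close>. \<open>u\<close> dominates the
  generating function at \<open>x / q\<close> and at 0, so that one bound \<open>D\<close> serves
  both. \<open>K v\<close> is the constant of \<open>expectation_power_lead_le\<close>.\<close>

lemma speed_deficit_bounds:
  assumes branching: "measure_pmf.prob p {x. 2 \<le> fst x} > 0"
    and q: "0 < q" and fq: "pgf (map_pmf fst p) q = q"
    and x: "0 < x" "x < q" and g: "joint_pgf p x q < x"
    and s: "q \<le> s" "s < 1" and t: "0 < t" "t < s" "pgf (map_pmf fst p) s \<le> t" "pgf (map_pmf fst p) t < t"
    and u: "0 < u" "u < 1" "pgf (map_pmf fst p) u < u"
      "pgf (map_pmf fst p) (x / q) \<le> u" "pgf (map_pmf fst p) 0 \<le> u"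
  defines "K v \<equiv> 1 / (1 - pgf (map_pmf fst p) v / v)"
  shows "1 - K t * (t / s) ^ N \<le> (1 - speed p N) / q ^ N"
    and "(1 - speed p N) / q ^ N \<le> 1 + ((x / q) ^ N + K u * u ^ N) / (1 - joint_pgf p x q / x) + K u * u ^ N"
proof -
  have q1: "q < 1" and s0: "0 < s" "0 \<le> s" "s \<le> 1" using s q by auto
  have le: "(\<integral>\<omega>. pgf (map_pmf fst p) y ^ lead_at k \<omega> \<partial>iid p) \<le> K v * v ^ N"
    if "0 \<le> y" "y \<le> 1" "pgf (map_pmf fst p) y \<le> v" "0 < v" "v < 1" "pgf (map_pmf fst p) v < v" for y v k
  proof -
    have "(\<integral>\<omega>. pgf (map_pmf fst p) y ^ lead_at k \<omega> \<partial>iid p) \<le> (\<integral>\<omega>. v ^ lead_at k \<omega> \<partial>iid p)"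
      using that by (intro integral_mono integrable_power_at power_mono pgf_nonneg pgf_le_1) auto
    also have "\<dots> \<le> v ^ N / (1 - pgf (map_pmf fst p) v / v)"
      by (rule expectation_power_lead_le) (use that in auto)
    finally show ?thesis by (simp add: K_def)
  qed
  define D where "D = K u * u ^ N"
  define U where "U = (x ^ N + q ^ N * D) / (1 - joint_pgf p x q / x)"
  have Dx: "(\<integral>\<omega>. pgf (map_pmf fst p) (x / q) ^ lead_at k \<omega> \<partial>iid p) \<le> D" for k
    unfolding D_def by (rule le) (use x q u in auto)
  have D0: "(\<integral>\<omega>. pgf (map_pmf fst p) 0 ^ lead_at k \<omega> \<partial>iid p) \<le> D" for k
    unfolding D_def by (rule le) (use u in auto)
  have U: "(\<integral>\<omega>. x ^ lead_at k \<omega> * q ^ second_at k \<omega> \<partial>iid p) \<le> U" for k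
    unfolding U_def by (rule expectation_power_lead_second_le[OF q q1 fq x g Dx])
  have M: "(\<integral>\<omega>. s ^ movers_at k \<omega> \<partial>iid p) \<le> K t * t ^ N" for k
    unfolding expectation_movers_at[OF s0(2,3)] by (rule le) (use s0 t s in auto)
  have b: "(\<integral>\<omega>. max 0 (q ^ N - q ^ movers_at k \<omega>) \<partial>iid p)
        + (\<integral>\<omega>. 0 ^ movers_at k \<omega> * q ^ lead_at (Suc k) \<omega> \<partial>iid p)
      \<in> {q ^ N * (1 - K t * t ^ N / s ^ N)..q ^ N + (U + q ^ N * D)}" for k
  proof -
    have "0 \<le> (\<integral>\<omega>. 0 ^ movers_at k \<omega> * q ^ lead_at (Suc k) \<omega> \<partial>iid p)"
      using q by (intro integral_nonneg_AE AE_I2) simp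
    then show ?thesis
      using excess_ge[OF q s M, of k] excess_le[OF q q1, of k]
        failure_small_lead_le[OF q q1 fq x g U D0, of k] by auto
  qed
  note B = failure_rate_bounds[OF branching q q1 fq b]
  have qN: "0 < q ^ N" using q by simp
  have "1 - K t * (t / s) ^ N = q ^ N * (1 - K t * t ^ N / s ^ N) / q ^ N"
    using q by (simp add: power_divide)
  also have "\<dots> \<le> (1 - speed p N) / q ^ N" using B(1) qN by (intro divide_right_mono) auto
  finally show "1 - K t * (t / s) ^ N \<le> (1 - speed p N) / q ^ N" .
  have "(1 - speed p N) / q ^ N \<le> (q ^ N + (U + q ^ N * D)) / q ^ N"
    using B(2) qN by (intro divide_right_mono) auto
  also have "\<dots> = 1 + U / q ^ N + D" using q by (simp add: add_divide_distrib)
  also have "U / q ^ N = ((x / q) ^ N + D) / (1 - joint_pgf p x q / x)"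
  proof -
    have "U / q ^ N = (x ^ N + q ^ N * D) / q ^ N / (1 - joint_pgf p x q / x)"
      by (simp add: U_def mult.commute)
    also have "(x ^ N + q ^ N * D) / q ^ N = (x / q) ^ N + D"
      using q by (simp add: add_divide_distrib power_divide)
    finally show ?thesis .
  qed
  finally show "(1 - speed p N) / q ^ N \<le> 1 + ((x / q) ^ N + K u * u ^ N) / (1 - joint_pgf p x q / x) + K u * u ^ N"
    unfolding D_def .
qed

end

section \<open>Choice of the parameters and passage to the limit\<close>

theorem theorem2:
  fixes p :: "(nat \<times> nat) pmf"
  assumes "(\<integral>\<^sup>+x. of_nat (fst x) \<partial>measure_pmf p) > 1"
    and "measure_pmf.prob p {x. fst x = 0} > 0"
    and "AE x in measure_pmf p. fst x + snd x \<ge> 1"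
  shows "(\<lambda>N. (1 - speed p N) / extinction_prob (map_pmf fst p) ^ N) \<longlonglongrightarrow> 1"
proof -
  let ?r = "map_pmf fst p"
  define q where "q = extinction_prob ?r"
  define p0 where "p0 = measure_pmf.prob p {x. fst x = 0}"
  have mean: "(\<integral>\<^sup>+x. of_nat x \<partial>measure_pmf ?r) > 1" using assms(1) by simp
  have "pmf ?r 0 = p0"
    by (simp add: p0_def pmf_map vimage_def)
  then have q: "0 < q" "q < 1" and fq: "pgf ?r q = q"
    using extinction_prob_pos[of ?r] extinction_prob_less_1[OF mean] extinction_prob_fixed[of ?r] assms(2)
    by (auto simp: q_def p0_def)
  \<comment> \<open>By \<open>joint_pgf_le\<close> the value \<open>joint_pgf p q q\<close> is below
    \<open>q\<close> by at least \<open>(1 - q) * p0\<close>. Half of this gap is kept to have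
    \<open>x < q\<close>, the other half gives \<open>joint_pgf p x q < x\<close>; the bound
    \<open>q / 2\<close> keeps \<open>x\<close> positive.\<close>
  define x where "x = max (q / 2) (q - (1 - q) * p0 / 2)"
  have c: "0 < (1 - q) * p0" using q assms(2) by (simp add: p0_def)
  have x: "0 < x" "x < q" using q c by (auto simp: x_def)
  have "joint_pgf p x q \<le> joint_pgf p q q"
    using x q by (intro joint_pgf_mono) auto
  also have "\<dots> \<le> pgf ?r q - (1 - q) * p0"
    unfolding p0_def using q by (intro joint_pgf_le assms(3)) auto
  also have "\<dots> < x" unfolding fq x_def using c by simp
  finally have g: "joint_pgf p x q < x" .
  obtain s where s: "q < s" "0 < s" "s < 1" "pgf ?r s < s" using ex_pgf_less[OF mean q(2)] by blast
  \<comment> \<open>By monotonicity any such \<open>t\<close> inherits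
    \<open>pgf ?r t \<le> pgf ?r s < t\<close>.\<close>
  obtain t where t: "pgf ?r s < t" "t < s" using dense[OF s(4)] by blast
  have t0: "0 < t" using t pgf_nonneg[of s ?r] s by simp
  have ft: "pgf ?r t < t" using pgf_mono[of t s ?r] t t0 s by simp
  have xq: "0 \<le> x / q" "x / q < 1" using x q by auto
  \<comment> \<open>\<open>w\<close> shows that \<open>pgf ?r (x / q)\<close> is less than 1, which
    allows \<open>u\<close> to be chosen above this value.\<close>
  obtain w where w: "x / q < w" "0 < w" "w < 1" "pgf ?r w < w"
    using ex_pgf_less[OF mean xq(2)] by blast
  have "pgf ?r (x / q) \<le> pgf ?r w" by (rule pgf_mono[OF xq(1)]) (use w in simp_all)
  then have "pgf ?r (x / q) < 1" using w by linarith
  from ex_pgf_less[OF mean this] obtain u where u: "pgf ?r (x / q) < u" "0 < u" "u < 1" "pgf ?r u < u"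
    by blast
  have "pgf ?r 0 \<le> pgf ?r (x / q)" by (rule pgf_mono[OF order.refl xq(1)]) (use xq in simp)
  then have u0: "pgf ?r 0 \<le> u" using u by linarith
  define K where "K v = 1 / (1 - pgf ?r v / v)" for v
  define R where "R = 1 - joint_pgf p x q / x"
  have small: "(\<lambda>N. y ^ N) \<longlonglongrightarrow> 0" if "0 < y" "y < 1" for y :: real
    using that by (intro LIMSEQ_power_zero) simp
  have R0: "R \<noteq> 0" using g x by (simp add: R_def)
  have "(\<lambda>N. (1 - speed p N) / q ^ N) \<longlonglongrightarrow> 1"
  proof (rule tendsto_sandwich)
    have "(\<lambda>N. 1 - K t * (t / s) ^ N) \<longlonglongrightarrow> 1 - K t * 0"
      by (intro tendsto_diff tendsto_mult tendsto_const small) (use t t0 s in auto)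
    then show "(\<lambda>N. 1 - K t * (t / s) ^ N) \<longlonglongrightarrow> 1" by simp
    have "(\<lambda>N. 1 + ((x / q) ^ N + K u * u ^ N) / R + K u * u ^ N) \<longlonglongrightarrow> 1 + (0 + K u * 0) / R + K u * 0"
      by (intro tendsto_add tendsto_divide tendsto_mult tendsto_const small) (use x q u R0 in auto)
    then show "(\<lambda>N. 1 + ((x / q) ^ N + K u * u ^ N) / R + K u * u ^ N) \<longlonglongrightarrow> 1" by simp
    note B = speed_deficit_bounds[OF assms(3) _ prob_ge_2_pos[OF assms(1)] q(1) fq x g less_imp_le[OF s(1)] s(3) t0 t(2)
        less_imp_le[OF t(1)] ft u(2,3,4) less_imp_le[OF u(1)] u0, folded K_def R_def]
    show "\<forall>\<^sub>F N in sequentially. 1 - K t * (t / s) ^ N \<le> (1 - speed p N) / q ^ N"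
      using eventually_gt_at_top[of 0] by eventually_elim (rule B(1))
    show "\<forall>\<^sub>F N in sequentially. (1 - speed p N) / q ^ N \<le> 1 + ((x / q) ^ N + K u * u ^ N) / R + K u * u ^ N"
      using eventually_gt_at_top[of 0] by eventually_elim (rule B(2))
  qed
  then show ?thesis by (simp add: q_def)
qed

end
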